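(* Let $\lambda_1,\lambda_2,\lambda_3,\lambda_4,\mu_1,\mu_2\in\mathbb{R}$ and let $G$ be a 5-dimensional real connected Lie group whose Lie algebra has a basis $\{E_1,\dots,E_5\}$ of left-invariant vector fields with non-zero commutators determined by $$[E_1,E_2]=-[E_3,E_4]=-\lambda_1E_1-\lambda_2E_2+\lambda_3E_3+\lambda_4E_4+2\mu_1E_5,$$ $$[E_1,E_4]=-[E_2,E_3]=-\lambda_3E_1-\lambda_4E_2-\lambda_1E_3-\lambda_2E_4+2\mu_2E_5.$$ Equip $G$ with the left-invariant almost contact B-metric structure $$\varphi E_1=E_3,\ \varphi E_2=E_4,\ \varphi E_3=-E_1,\ \varphi E_4=-E_2,\ \varphi E_5=0;\quad \xi=E_5;\quad \eta(E_i)=0\ (i=1,2,3,4),\ \eta(E_5)=1;$$ $$g(E_1,E_1)=g(E_2,E_2)=-g(E_3,E_3)=-g(E_4,E_4)=g(E_5,E_5)=1,\quad g(E_i,E_j)=0\ (i\neq j).$$ Then $(G,\varphi,\xi,\eta,g)$ belongs to the class $\mathcal{F}_7$.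
   Context: An almost contact B-metric manifold $(M,\varphi,\xi,\eta,g)$ is a $(2n+1)$-dimensional smooth manifold $M$ with a field of endomorphisms $\varphi$ of the tangent bundle, a vector field $\xi$, a 1-form $\eta$ and a pseudo-Riemannian metric $g$ of signature $(n,n+1)$ ($n$ negative and $n+1$ positive directions) such that $\varphi\xi=0$, $\varphi^2=-\mathrm{Id}+\eta\otimes\xi$, $\eta\circ\varphi=0$, $\eta(\xi)=1$, $g(\varphi x,\varphi y)=-g(x,y)+\eta(x)\eta(y)$. $\nabla$ is the Levi-Civita connection of $g$ and $F(x,y,z)=g((\nabla_x\varphi)y,z)$. The manifold belongs to the class $\mathcal{F}_7$ if $F(x,y,z)+F(y,z,x)+F(z,x,y)=0$ and $F(x,y,z)=-F(\varphi x,\varphi y,z)-F(\varphi x,y,\varphi z)$ for all $x,y,z$ (the case $F=0$ is included). The brackets of basis vectors not listed and not obtained by skew-symmetry are zero. *)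

theory Defs
  imports "HOL-Analysis.Analysis" "HOL-Algebra.Group"
begin

section \<open>Smooth manifolds\<close>

text \<open>Only meant for open \<open>S\<close>: there the Frechet derivative is determined by the values on \<open>S\<close>.\<close>

primrec Ck_on :: "nat \<Rightarrow> 'e::euclidean_space set \<Rightarrow> ('e \<Rightarrow> 'f::real_normed_vector) \<Rightarrow> bool" where
  "Ck_on 0 S f \<longleftrightarrow> continuous_on S f"
| "Ck_on (Suc k) S f \<longleftrightarrow>
     f differentiable_on S \<and> (\<forall>v. Ck_on k S (\<lambda>x. frechet_derivative f (at x) v))"

definition smooth_on :: "'e::euclidean_space set \<Rightarrow> ('e \<Rightarrow> 'f::real_normed_vector) \<Rightarrow> bool" where
  "smooth_on S f \<longleftrightarrow> (\<forall>k. Ck_on k S f)"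

text \<open>A chart is a pair of an open domain and a coordinate map, which is irrelevant off the domain.\<close>

type_synonym ('a, 'e) atlas = "('a set \<times> ('a \<Rightarrow> 'e)) set"

definition smooth_atlas :: "('a::{t2_space,second_countable_topology}, 'e::euclidean_space) atlas \<Rightarrow> bool" where
  "smooth_atlas A \<longleftrightarrow>
     (\<Union>(U, c)\<in>A. U) = UNIV \<and>
     (\<forall>(U, c)\<in>A. open U \<and> open (c ` U) \<and> homeomorphism U (c ` U) c (inv_into U c)) \<and>
     (\<forall>(U, c)\<in>A. \<forall>(V, d)\<in>A. smooth_on (c ` (U \<inter> V)) (d \<circ> inv_into U c))"

definition smooth_map ::
  "('a::topological_space, 'e::euclidean_space) atlas \<Rightarrow> ('b::topological_space, 'f::euclidean_space) atlas \<Rightarrow>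
   ('a \<Rightarrow> 'b) \<Rightarrow> bool" where
  "smooth_map A B h \<longleftrightarrow> continuous_on UNIV h \<and>
     (\<forall>(U, c)\<in>A. \<forall>(V, d)\<in>B. smooth_on (c ` (U \<inter> h -` V)) (d \<circ> h \<circ> inv_into U c))"

definition prod_atlas :: "('a, 'e) atlas \<Rightarrow> ('b, 'f) atlas \<Rightarrow> ('a \<times> 'b, 'e \<times> 'f) atlas" where
  "prod_atlas A B = {(U \<times> V, map_prod c d) | U c V d. (U, c) \<in> A \<and> (V, d) \<in> B}"

definition smooth_fun_on ::
  "('a::topological_space, 'e::euclidean_space) atlas \<Rightarrow> 'a set \<Rightarrow> ('a \<Rightarrow> real) \<Rightarrow> bool" where
  "smooth_fun_on A W f \<longleftrightarrow> (\<forall>(U, c)\<in>A. smooth_on (c ` (U \<inter> W)) (f \<circ> inv_into U c))"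

definition smooth_at ::
  "('a::topological_space, 'e::euclidean_space) atlas \<Rightarrow> 'a \<Rightarrow> ('a \<Rightarrow> real) \<Rightarrow> bool" where
  "smooth_at A p f \<longleftrightarrow> (\<exists>W. open W \<and> p \<in> W \<and> smooth_fun_on A W f)"


section \<open>Tangent vectors and vector fields\<close>

text \<open>
  A tangent vector at \<open>p\<close> is a derivation of the algebra of germs at \<open>p\<close> of smooth functions.
  It is represented as a functional on all functions, with value 0 on those not
  smooth at \<open>p\<close>, so that equality of tangent vectors is equality of functionals.
\<close>

type_synonym 'a tvec = "('a \<Rightarrow> real) \<Rightarrow> real"
type_synonym 'a vfield = "'a \<Rightarrow> 'a tvec"

definition tangent_space ::
  "('a::topological_space, 'e::euclidean_space) atlas \<Rightarrow> 'a \<Rightarrow> 'a tvec set" where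
  "tangent_space A p = {v.
     (\<forall>f g a b. smooth_at A p f \<longrightarrow> smooth_at A p g \<longrightarrow>
        v (\<lambda>q. a * f q + b * g q) = a * v f + b * v g) \<and>
     (\<forall>f g. smooth_at A p f \<longrightarrow> smooth_at A p g \<longrightarrow>
        v (\<lambda>q. f q * g q) = f p * v g + g p * v f) \<and>
     (\<forall>f g. smooth_at A p f \<longrightarrow> eventually (\<lambda>q. f q = g q) (nhds p) \<longrightarrow> v f = v g) \<and>
     (\<forall>f. \<not> smooth_at A p f \<longrightarrow> v f = 0)}"

definition tcomb :: "real \<Rightarrow> 'a tvec \<Rightarrow> real \<Rightarrow> 'a tvec \<Rightarrow> 'a tvec" where
  "tcomb a u b v = (\<lambda>f. a * u f + b * v f)"

definition tzero :: "'a tvec" where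
  "tzero = (\<lambda>f. 0)"

definition vector_field ::
  "('a::topological_space, 'e::euclidean_space) atlas \<Rightarrow> 'a vfield \<Rightarrow> bool" where
  "vector_field A X \<longleftrightarrow> (\<forall>p. X p \<in> tangent_space A p) \<and>
     (\<forall>W f. open W \<longrightarrow> smooth_fun_on A W f \<longrightarrow> smooth_fun_on A W (\<lambda>p. X p f))"

definition lie_bracket ::
  "('a::topological_space, 'e::euclidean_space) atlas \<Rightarrow> 'a vfield \<Rightarrow> 'a vfield \<Rightarrow> 'a vfield" where
  "lie_bracket A X Y = (\<lambda>p f. if smooth_at A p f
     then X p (\<lambda>q. Y q f) - Y p (\<lambda>q. X q f) else 0)"


section \<open>Tensor fields\<close>

definition one_form ::
  "('a::topological_space, 'e::euclidean_space) atlas \<Rightarrow> ('a \<Rightarrow> 'a tvec \<Rightarrow> real) \<Rightarrow> bool" where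
  "one_form A \<eta> \<longleftrightarrow>
     (\<forall>p. \<forall>u\<in>tangent_space A p. \<forall>v\<in>tangent_space A p. \<forall>a b.
        \<eta> p (tcomb a u b v) = a * \<eta> p u + b * \<eta> p v) \<and>
     (\<forall>X. vector_field A X \<longrightarrow> smooth_fun_on A UNIV (\<lambda>p. \<eta> p (X p)))"

definition endo_field ::
  "('a::topological_space, 'e::euclidean_space) atlas \<Rightarrow> ('a \<Rightarrow> 'a tvec \<Rightarrow> 'a tvec) \<Rightarrow> bool" where
  "endo_field A \<phi> \<longleftrightarrow>
     (\<forall>p. \<forall>v\<in>tangent_space A p. \<phi> p v \<in> tangent_space A p) \<and>
     (\<forall>p. \<forall>u\<in>tangent_space A p. \<forall>v\<in>tangent_space A p. \<forall>a b.
        \<phi> p (tcomb a u b v) = tcomb a (\<phi> p u) b (\<phi> p v)) \<and>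
     (\<forall>X. vector_field A X \<longrightarrow> vector_field A (\<lambda>p. \<phi> p (X p)))"

definition bilinear_field ::
  "('a::topological_space, 'e::euclidean_space) atlas \<Rightarrow> ('a \<Rightarrow> 'a tvec \<Rightarrow> 'a tvec \<Rightarrow> real) \<Rightarrow> bool" where
  "bilinear_field A g \<longleftrightarrow>
     (\<forall>p. \<forall>u\<in>tangent_space A p. \<forall>v\<in>tangent_space A p. \<forall>w\<in>tangent_space A p. \<forall>a b.
        g p (tcomb a u b v) w = a * g p u w + b * g p v w \<and>
        g p w (tcomb a u b v) = a * g p w u + b * g p w v) \<and>
     (\<forall>X Y. vector_field A X \<longrightarrow> vector_field A Y \<longrightarrow> smooth_fun_on A UNIV (\<lambda>p. g p (X p) (Y p)))"

text \<open>
  Signature with \<open>r\<close> negative and \<open>s\<close> positive directions: every tangent space has a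
  pseudo-orthonormal basis of that kind (its linear independence, and hence
  nondegeneracy of the metric, follow from pseudo-orthonormality and spanning).
\<close>

definition pseudo_riemannian_metric ::
  "nat \<Rightarrow> nat \<Rightarrow> ('a::topological_space, 'e::euclidean_space) atlas \<Rightarrow>
   ('a \<Rightarrow> 'a tvec \<Rightarrow> 'a tvec \<Rightarrow> real) \<Rightarrow> bool" where
  "pseudo_riemannian_metric r s A g \<longleftrightarrow>
     bilinear_field A g \<and>
     (\<forall>p. \<forall>u\<in>tangent_space A p. \<forall>v\<in>tangent_space A p. g p u v = g p v u) \<and>
     (\<forall>p. \<exists>e. (\<forall>i<r + s. e i \<in> tangent_space A p) \<and>
        (\<forall>v\<in>tangent_space A p. \<exists>c. v = (\<lambda>f. \<Sum>i<r + s. c i * e i f)) \<and>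
        (\<forall>i<r + s. \<forall>j<r + s. g p (e i) (e j) = (if i \<noteq> j then 0 else if i < r then -1 else 1)))"


section \<open>The Levi-Civita connection\<close>

definition affine_connection ::
  "('a::topological_space, 'e::euclidean_space) atlas \<Rightarrow> ('a vfield \<Rightarrow> 'a vfield \<Rightarrow> 'a vfield) \<Rightarrow> bool" where
  "affine_connection A nabla \<longleftrightarrow>
     (\<forall>X Y. vector_field A X \<longrightarrow> vector_field A Y \<longrightarrow> vector_field A (nabla X Y)) \<and>
     (\<forall>X Y Z f h. vector_field A X \<longrightarrow> vector_field A Y \<longrightarrow> vector_field A Z \<longrightarrow>
        smooth_fun_on A UNIV f \<longrightarrow> smooth_fun_on A UNIV h \<longrightarrow>
        nabla (\<lambda>p. tcomb (f p) (X p) (h p) (Y p)) Z = (\<lambda>p. tcomb (f p) (nabla X Z p) (h p) (nabla Y Z p))) \<and>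
     (\<forall>X Y Z a b. vector_field A X \<longrightarrow> vector_field A Y \<longrightarrow> vector_field A Z \<longrightarrow>
        nabla X (\<lambda>p. tcomb a (Y p) b (Z p)) = (\<lambda>p. tcomb a (nabla X Y p) b (nabla X Z p))) \<and>
     (\<forall>X Y f. vector_field A X \<longrightarrow> vector_field A Y \<longrightarrow> smooth_fun_on A UNIV f \<longrightarrow>
        nabla X (\<lambda>p u. f p * Y p u) = (\<lambda>p. tcomb (X p f) (Y p) (f p) (nabla X Y p)))"

definition is_levi_civita ::
  "('a::topological_space, 'e::euclidean_space) atlas \<Rightarrow> ('a \<Rightarrow> 'a tvec \<Rightarrow> 'a tvec \<Rightarrow> real) \<Rightarrow>
   ('a vfield \<Rightarrow> 'a vfield \<Rightarrow> 'a vfield) \<Rightarrow> bool" where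
  "is_levi_civita A g nabla \<longleftrightarrow>
     affine_connection A nabla \<and>
     (\<forall>X Y. vector_field A X \<longrightarrow> vector_field A Y \<longrightarrow>
        (\<lambda>p. tcomb 1 (nabla X Y p) (-1) (nabla Y X p)) = lie_bracket A X Y) \<and>
     (\<forall>X Y Z p. vector_field A X \<longrightarrow> vector_field A Y \<longrightarrow> vector_field A Z \<longrightarrow>
        X p (\<lambda>q. g q (Y q) (Z q)) = g p (nabla X Y p) (Z p) + g p (Y p) (nabla X Z p))"

text \<open>
  The Levi-Civita connection is unique as an operator on vector fields; the choice
  below is arbitrary only on arguments that are not vector fields, so \<open>THE\<close> would not do.
\<close>

definition levi_civita ::
  "('a::topological_space, 'e::euclidean_space) atlas \<Rightarrow> ('a \<Rightarrow> 'a tvec \<Rightarrow> 'a tvec \<Rightarrow> real) \<Rightarrow>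
   'a vfield \<Rightarrow> 'a vfield \<Rightarrow> 'a vfield" where
  "levi_civita A g = (SOME nabla. is_levi_civita A g nabla)"


section \<open>Almost contact B-metric manifolds and the class F7\<close>

definition almost_contact_B_metric_manifold ::
  "('a::{t2_space,second_countable_topology}, 'e::euclidean_space) atlas \<Rightarrow> ('a \<Rightarrow> 'a tvec \<Rightarrow> 'a tvec) \<Rightarrow>
   'a vfield \<Rightarrow> ('a \<Rightarrow> 'a tvec \<Rightarrow> real) \<Rightarrow> ('a \<Rightarrow> 'a tvec \<Rightarrow> 'a tvec \<Rightarrow> real) \<Rightarrow> bool" where
  "almost_contact_B_metric_manifold A \<phi> \<xi> \<eta> g \<longleftrightarrow>
     smooth_atlas A \<and> endo_field A \<phi> \<and> vector_field A \<xi> \<and> one_form A \<eta> \<and>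
     (\<exists>n. DIM('e) = 2 * n + 1 \<and> pseudo_riemannian_metric n (n + 1) A g) \<and>
     (\<forall>p. \<phi> p (\<xi> p) = tzero) \<and>
     (\<forall>p. \<forall>x\<in>tangent_space A p. \<phi> p (\<phi> p x) = tcomb (-1) x (\<eta> p x) (\<xi> p)) \<and>
     (\<forall>p. \<forall>x\<in>tangent_space A p. \<eta> p (\<phi> p x) = 0) \<and>
     (\<forall>p. \<eta> p (\<xi> p) = 1) \<and>
     (\<forall>p. \<forall>x\<in>tangent_space A p. \<forall>y\<in>tangent_space A p.
        g p (\<phi> p x) (\<phi> p y) = - g p x y + \<eta> p x * \<eta> p y)"

text \<open>\<open>(\<nabla>\<^sub>x \<phi>) y = \<nabla>\<^sub>x (\<phi> y) - \<phi> (\<nabla>\<^sub>x y)\<close>\<close>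

definition fundamental_tensor ::
  "('a::topological_space, 'e::euclidean_space) atlas \<Rightarrow> ('a \<Rightarrow> 'a tvec \<Rightarrow> 'a tvec) \<Rightarrow>
   ('a \<Rightarrow> 'a tvec \<Rightarrow> 'a tvec \<Rightarrow> real) \<Rightarrow> 'a vfield \<Rightarrow> 'a vfield \<Rightarrow> 'a vfield \<Rightarrow> 'a \<Rightarrow> real" where
  "fundamental_tensor A \<phi> g X Y Z p =
     g p (tcomb 1 (levi_civita A g X (\<lambda>q. \<phi> q (Y q)) p) (-1) (\<phi> p (levi_civita A g X Y p))) (Z p)"

definition class_F7 ::
  "('a::{t2_space,second_countable_topology}, 'e::euclidean_space) atlas \<Rightarrow> ('a \<Rightarrow> 'a tvec \<Rightarrow> 'a tvec) \<Rightarrow>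
   'a vfield \<Rightarrow> ('a \<Rightarrow> 'a tvec \<Rightarrow> real) \<Rightarrow> ('a \<Rightarrow> 'a tvec \<Rightarrow> 'a tvec \<Rightarrow> real) \<Rightarrow> bool" where
  "class_F7 A \<phi> \<xi> \<eta> g \<longleftrightarrow>
     almost_contact_B_metric_manifold A \<phi> \<xi> \<eta> g \<and>
     (let F = fundamental_tensor A \<phi> g; \<Phi> = (\<lambda>X p. \<phi> p (X p)) in
      \<forall>X Y Z p. vector_field A X \<longrightarrow> vector_field A Y \<longrightarrow> vector_field A Z \<longrightarrow>
        F X Y Z p + F Y Z X p + F Z X Y p = 0 \<and>
        F X Y Z p = - F (\<Phi> X) (\<Phi> Y) Z p - F (\<Phi> X) Y (\<Phi> Z) p)"


section \<open>Lie groups and left-invariant fields\<close>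

definition lie_group ::
  "('a::{t2_space,second_countable_topology}) monoid \<Rightarrow> ('a, 'e::euclidean_space) atlas \<Rightarrow> bool" where
  "lie_group G A \<longleftrightarrow> smooth_atlas A \<and> group G \<and> carrier G = UNIV \<and>
     smooth_map (prod_atlas A A) A (\<lambda>(a, b). a \<otimes>\<^bsub>G\<^esub> b) \<and>
     smooth_map A A (\<lambda>a. inv\<^bsub>G\<^esub> a)"

text \<open>The differential of the left translation by \<open>a\<close>\<close>

definition dL :: "'a monoid \<Rightarrow> 'a \<Rightarrow> 'a tvec \<Rightarrow> 'a tvec" where
  "dL G a v = (\<lambda>f. v (\<lambda>q. f (a \<otimes>\<^bsub>G\<^esub> q)))"

definition left_invariant_vector_field ::
  "'a::topological_space monoid \<Rightarrow> ('a, 'e::euclidean_space) atlas \<Rightarrow> 'a vfield \<Rightarrow> bool" where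
  "left_invariant_vector_field G A X \<longleftrightarrow> vector_field A X \<and> (\<forall>a p. X (a \<otimes>\<^bsub>G\<^esub> p) = dL G a (X p))"

definition left_invariant_one_form ::
  "'a::topological_space monoid \<Rightarrow> ('a, 'e::euclidean_space) atlas \<Rightarrow> ('a \<Rightarrow> 'a tvec \<Rightarrow> real) \<Rightarrow> bool" where
  "left_invariant_one_form G A \<eta> \<longleftrightarrow> one_form A \<eta> \<and>
     (\<forall>a p. \<forall>v\<in>tangent_space A p. \<eta> (a \<otimes>\<^bsub>G\<^esub> p) (dL G a v) = \<eta> p v)"

definition left_invariant_endo_field ::
  "'a::topological_space monoid \<Rightarrow> ('a, 'e::euclidean_space) atlas \<Rightarrow> ('a \<Rightarrow> 'a tvec \<Rightarrow> 'a tvec) \<Rightarrow> bool" where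
  "left_invariant_endo_field G A \<phi> \<longleftrightarrow> endo_field A \<phi> \<and>
     (\<forall>a p. \<forall>v\<in>tangent_space A p. \<phi> (a \<otimes>\<^bsub>G\<^esub> p) (dL G a v) = dL G a (\<phi> p v))"

definition left_invariant_bilinear_field ::
  "'a::topological_space monoid \<Rightarrow> ('a, 'e::euclidean_space) atlas \<Rightarrow>
   ('a \<Rightarrow> 'a tvec \<Rightarrow> 'a tvec \<Rightarrow> real) \<Rightarrow> bool" where
  "left_invariant_bilinear_field G A g \<longleftrightarrow> bilinear_field A g \<and>
     (\<forall>a p. \<forall>u\<in>tangent_space A p. \<forall>v\<in>tangent_space A p.
        g (a \<otimes>\<^bsub>G\<^esub> p) (dL G a u) (dL G a v) = g p u v)"

text \<open>The Lie algebra of the group is the space of left-invariant vector fields under the bracket.\<close>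

definition lie_algebra_basis ::
  "'a::topological_space monoid \<Rightarrow> ('a, 'e::euclidean_space) atlas \<Rightarrow> nat set \<Rightarrow> (nat \<Rightarrow> 'a vfield) \<Rightarrow> bool" where
  "lie_algebra_basis G A I E \<longleftrightarrow> finite I \<and>
     (\<forall>i\<in>I. left_invariant_vector_field G A (E i)) \<and>
     (\<forall>X. left_invariant_vector_field G A X \<longrightarrow> (\<exists>c. X = (\<lambda>p f. \<Sum>i\<in>I. c i * E i p f))) \<and>
     (\<forall>c. (\<lambda>p f. \<Sum>i\<in>I. c i * E i p f) = (\<lambda>p. tzero) \<longrightarrow> (\<forall>i\<in>I. c i = 0))"

end

theory Submission
  imports Defs
begin

text \<open>
  A tangent vector is a derivation of germs, so Hadamard's lemma bounds the dimension of the
  tangent space by that of the model space; hence five pseudo-orthonormal left-invariant fields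
  form a global frame. In such a frame the Levi-Civita connection has constant coefficients, given
  by Koszul's formula from the structure constants, and the fundamental tensor is
  \<open>F(x,y,z) = \<omega>(x,y) \<eta>(z) + \<omega>(x,z) \<eta>(y)\<close> with the 2-form
  \<open>\<omega> = m2 (e1 \<and> e2 - e3 \<and> e4) - m1 (e1 \<and> e4 - e2 \<and> e3)\<close>; the \<open>l1, \<dots>, l4\<close> cancel.
  Both identities defining the class follow, because \<open>\<omega>\<close> is alternating and
  \<open>\<omega>(\<phi> x, \<phi> y) = - \<omega>(x,y)\<close>.
\<close>

section \<open>Functions of class C^k on open sets\<close>

text \<open>The obstacle is that the frame must span every single tangent space. A Lie algebra basis
  spans the left-invariant fields, and reaching one tangent vector from there would mean extending
  it to a smooth left-invariant field. Pseudo-orthonormality gives pointwise independence instead,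
  and the dimension bound turns independence into spanning. The class is tested on all vector
  fields, so components are functions whose derivatives must be carried along; they drop out of the
  fundamental tensor because \<phi> has a constant matrix. As \<open>levi_civita\<close> is a
  choice, a connection also has to be exhibited. Why \<open>l1, ..., l4\<close> cancel: let
  \<open>B\<close> be the \<open>E 1, ..., E 4\<close> part of the bracket. The listed brackets give
  \<open>B(x, \<phi> y) = \<phi> B(x, y)\<close> for x, y in the span of
  \<open>E 1, ..., E 4\<close>, and \<phi> is symmetric for \<open>g\<close>, so the part of
  Koszul's formula that comes from \<open>B\<close> commutes with \<phi>. Only the
  \<open>E 5\<close> components of the brackets survive.\<close>

lemma Ck_on_cong:
  assumes "open S" "\<And>x. x \<in> S \<Longrightarrow> f x = g x" "Ck_on k S f"
  shows "Ck_on k S g"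
  using assms(2,3)
proof (induction k arbitrary: f g)
  case 0
  then show ?case by (simp cong: continuous_on_cong)
next
  case (Suc k)
  have "g differentiable_on S"
    using Suc.prems has_derivative_transform[of _ S g f]
    unfolding differentiable_on_def differentiable_def Ck_on.simps by metis
  moreover have "frechet_derivative f (at x) v = frechet_derivative g (at x) v" if "x \<in> S" for x v
  proof -
    have "f differentiable at x"
      using Suc.prems(2) that \<open>open S\<close> by (simp add: differentiable_on_eq_differentiable_at)
    then show ?thesis
      using frechet_derivative_transform_within_open[of f x S g] \<open>open S\<close> that Suc.prems(1) by simp
  qed
  ultimately show ?case
    using Suc.prems(2) Suc.IH[of "\<lambda>x. frechet_derivative f (at x) _" "\<lambda>x. frechet_derivative g (at x) _"]
    by simp
qed

lemma Ck_on_subset: "Ck_on k S f \<Longrightarrow> T \<subseteq> S \<Longrightarrow> Ck_on k T f"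
  by (induction k arbitrary: f) (auto intro: continuous_on_subset differentiable_on_subset)

lemma Ck_on_SucD: "Ck_on (Suc k) S f \<Longrightarrow> Ck_on k S f"
  by (induction k arbitrary: f) (auto intro: differentiable_imp_continuous_on)

text \<open>\<open>Ck_on\<close> speaks of the chosen \<open>frechet_derivative\<close>. Uniqueness
  of the derivative lets the closure proofs below work with an explicit formula \<open>D\<close>
  instead.\<close>

lemma Ck_on_SucI:
  assumes "open S" "\<And>x. x \<in> S \<Longrightarrow> (f has_derivative D x) (at x)"
    "\<And>v. Ck_on k S (\<lambda>x. D x v)"
  shows "Ck_on (Suc k) S f"
proof -
  have "f differentiable_on S"
    using assms(1,2) by (auto simp: differentiable_on_eq_differentiable_at differentiable_def)
  moreover have "Ck_on k S (\<lambda>x. frechet_derivative f (at x) v)" for v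
    by (rule Ck_on_cong[OF assms(1) _ assms(3)[of v]]) (use frechet_derivative_at[OF assms(2)] in simp)
  ultimately show ?thesis by simp
qed

lemma Ck_on_SucE:
  assumes "open S" "Ck_on (Suc k) S f" "x \<in> S"
  shows "(f has_derivative frechet_derivative f (at x)) (at x)"
  using assms by (simp add: differentiable_on_eq_differentiable_at frechet_derivative_works)

lemma Ck_on_const: "open S \<Longrightarrow> Ck_on k S (\<lambda>x. c)"
proof (induction k arbitrary: c)
  case (Suc k)
  show ?case
    by (rule Ck_on_SucI[where D="\<lambda>x v. 0"]) (auto intro: Suc)
qed simp

lemma Ck_on_bounded_linear:
  assumes "open S" "bounded_linear L" "Ck_on k S f"
  shows "Ck_on k S (\<lambda>x. L (f x))"
  using assms(3)
proof (induction k arbitrary: f)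
  case 0
  then show ?case
    using assms(2) by (simp add: bounded_linear.continuous_on)
next
  case (Suc k)
  show ?case
  proof (rule Ck_on_SucI[OF \<open>open S\<close>])
    show "((\<lambda>x. L (f x)) has_derivative (\<lambda>v. L (frechet_derivative f (at x) v))) (at x)" if "x \<in> S" for x
      using bounded_linear.has_derivative[OF assms(2) Ck_on_SucE[OF assms(1) Suc.prems that]] .
  qed (use Suc in simp)
qed

lemma Ck_on_add:
  assumes "open S" "Ck_on k S f" "Ck_on k S g"
  shows "Ck_on k S (\<lambda>x. f x + g x)"
  using assms(2,3)
proof (induction k arbitrary: f g)
  case 0
  then show ?case by (simp add: continuous_on_add)
next
  case (Suc k)
  show ?case
  proof (rule Ck_on_SucI[OF \<open>open S\<close>])
    show "((\<lambda>x. f x + g x) has_derivative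
        (\<lambda>v. frechet_derivative f (at x) v + frechet_derivative g (at x) v)) (at x)" if "x \<in> S" for x
      using Ck_on_SucE[OF assms(1) Suc.prems(1) that] Ck_on_SucE[OF assms(1) Suc.prems(2) that]
      by (rule has_derivative_add)
  qed (use Suc in simp)
qed

lemma Ck_on_mult:
  fixes f g :: "'e::euclidean_space \<Rightarrow> real"
  assumes "open S" "Ck_on k S f" "Ck_on k S g"
  shows "Ck_on k S (\<lambda>x. f x * g x)"
  using assms(2,3)
proof (induction k arbitrary: f g)
  case 0
  then show ?case by (simp add: continuous_on_mult)
next
  case (Suc k)
  show ?case
  proof (rule Ck_on_SucI[OF \<open>open S\<close>])
    show "((\<lambda>x. f x * g x) has_derivative
        (\<lambda>v. f x * frechet_derivative g (at x) v + frechet_derivative f (at x) v * g x)) (at x)"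
      if "x \<in> S" for x
      using Ck_on_SucE[OF assms(1) Suc.prems(1) that] Ck_on_SucE[OF assms(1) Suc.prems(2) that]
      by (rule has_derivative_mult)
    show "Ck_on k S (\<lambda>x. f x * frechet_derivative g (at x) v + frechet_derivative f (at x) v * g x)" for v
      using Suc by (intro Ck_on_add[OF assms(1)] Suc.IH) (auto intro: Ck_on_SucD)
  qed
qed

lemma Ck_on_sum:
  assumes "open S" "finite I" "\<And>i. i \<in> I \<Longrightarrow> Ck_on k S (f i)"
  shows "Ck_on k S (\<lambda>x. \<Sum>i\<in>I. f i x)"
  using assms(2,3)
proof (induction I rule: finite_induct)
  case empty
  then show ?case using Ck_on_const[OF assms(1), of k 0] by simp
next
  case (insert i I)
  then show ?case using Ck_on_add[OF assms(1), of k "f i"] by simp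
qed

lemma Ck_on_compose:
  fixes h :: "'f::euclidean_space \<Rightarrow> real" and \<phi> :: "'e::euclidean_space \<Rightarrow> 'f"
  assumes "open S" "open T" "\<phi> ` S \<subseteq> T" "Ck_on k T h" "Ck_on k S \<phi>"
  shows "Ck_on k S (\<lambda>x. h (\<phi> x))"
  using assms(4,5)
proof (induction k arbitrary: h)
  case 0
  then show ?case using assms(3) by (auto intro: continuous_on_compose2)
next
  case (Suc k)
  \<comment> \<open>Expanding the outer derivative in \<open>Basis\<close> turns the chain rule into
    a sum of products of real functions, to which the closure lemmas and the induction hypothesis
    apply.\<close>
  let ?D = "\<lambda>x v. \<Sum>b\<in>Basis. frechet_derivative h (at (\<phi> x)) b * (frechet_derivative \<phi> (at x) v \<bullet> b)"
  show ?case
  proof (rule Ck_on_SucI[OF \<open>open S\<close>])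
    fix x assume x: "x \<in> S"
    then have px: "\<phi> x \<in> T" using assms(3) by auto
    note h = Ck_on_SucE[OF assms(2) Suc.prems(1) px]
    have chain: "((\<lambda>x. h (\<phi> x)) has_derivative
        (\<lambda>v. frechet_derivative h (at (\<phi> x)) (frechet_derivative \<phi> (at x) v))) (at x)"
      using diff_chain_at[OF Ck_on_SucE[OF assms(1) Suc.prems(2) x] h] by (simp add: o_def)
    have expand: "frechet_derivative h (at (\<phi> x)) w = (\<Sum>b\<in>Basis. frechet_derivative h (at (\<phi> x)) b * (w \<bullet> b))" for w
    proof -
      interpret linear "frechet_derivative h (at (\<phi> x))"
        using h has_derivative_linear by blast
      have "frechet_derivative h (at (\<phi> x)) w
          = frechet_derivative h (at (\<phi> x)) (\<Sum>b\<in>Basis. (w \<bullet> b) *\<^sub>R b)"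
        by (simp add: euclidean_representation)
      then show ?thesis by (simp only: sum scale real_scaleR_def mult.commute[of "w \<bullet> _"])
    qed
    show "((\<lambda>x. h (\<phi> x)) has_derivative ?D x) (at x)"
      by (rule has_derivative_eq_rhs[OF chain], rule ext, rule expand)
  next
    fix v
    show "Ck_on k S (\<lambda>x. ?D x v)"
    proof (intro Ck_on_sum Ck_on_mult assms(1) finite_Basis)
      fix b :: 'f
      show "Ck_on k S (\<lambda>x. frechet_derivative h (at (\<phi> x)) b)"
        using Suc.prems Ck_on_SucD[of k S \<phi>] by (intro Suc.IH) auto
      show "Ck_on k S (\<lambda>x. frechet_derivative \<phi> (at x) v \<bullet> b)"
        using Suc.prems(2) by (intro Ck_on_bounded_linear[OF assms(1) bounded_linear_inner_left]) simp
    qed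
  qed
qed

section \<open>Hadamard's lemma\<close>

lemma ray_in_convex:
  assumes "convex S" "x0 \<in> S" "x \<in> S" "0 \<le> t" "t \<le> (1::real)"
  shows "x0 + t *\<^sub>R (x - x0) \<in> S"
proof -
  have "x0 + t *\<^sub>R (x - x0) = (1 - t) *\<^sub>R x0 + t *\<^sub>R x" by (simp add: algebra_simps)
  then show ?thesis using assms by (simp add: convexD)
qed

text \<open>The codomain is a general normed space because this serves both the real function and
  its derivative as a bounded linear map.\<close>

lemma continuous_on_ray_integrand:
  fixes F :: "'e::euclidean_space \<Rightarrow> 'b::real_normed_vector"
  assumes "convex S" "x0 \<in> S" "continuous_on S F"
  shows "continuous_on (S \<times> {0..1}) (\<lambda>(x, t). (t ^ m) *\<^sub>R F (x0 + t *\<^sub>R (x - x0)))"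
  unfolding case_prod_beta
  using assms ray_in_convex[OF assms(1,2)]
  by (intro continuous_intros continuous_on_compose2[OF assms(3)]) auto

text \<open>Differentiating under the integral sign in \<open>x\<close> brings out a factor
  \<open>t\<close> from the chain rule. The weight \<open>t ^ m\<close> absorbs it, so the induction
  closes with \<open>m\<close> replaced by \<open>Suc m\<close>; Hadamard's lemma uses
  \<open>m = 0\<close>.\<close>

lemma Ck_on_ray_integral:
  fixes F :: "'e::euclidean_space \<Rightarrow> real"
  assumes "open S" "convex S" "x0 \<in> S" "Ck_on k S F"
  shows "Ck_on k S (\<lambda>x. integral {0..1} (\<lambda>t. t ^ m * F (x0 + t *\<^sub>R (x - x0))))"
  using assms(4)
proof (induction k arbitrary: F m)
  case 0
  then show ?case
    using integral_continuous_on_param[of S 0 1 "\<lambda>x t. t ^ m *\<^sub>R F (x0 + t *\<^sub>R (x - x0))"]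
      continuous_on_ray_integrand[OF assms(2,3), of F m] by simp
next
  case (Suc k)
  let ?y = "\<lambda>x t::real. x0 + t *\<^sub>R (x - x0)"
  \<comment> \<open>Leibniz's rule wants the derivative as a continuous map into bounded linear
    maps. In finite dimension this follows from continuity of each directional derivative.\<close>
  let ?F' = "\<lambda>x. Blinfun (frechet_derivative F (at x))"
  have F': "blinfun_apply (?F' x) = frechet_derivative F (at x)" if "x \<in> S" for x
    using Ck_on_SucE[OF assms(1) Suc.prems that] has_derivative_bounded_linear
    by (intro bounded_linear_Blinfun_apply) blast
  have Fcont: "continuous_on S F"
    using Suc.prems differentiable_imp_continuous_on by auto
  have "continuous_on S (\<lambda>x. frechet_derivative F (at x) v)" for v
  proof -
    have "Ck_on k S (\<lambda>x. frechet_derivative F (at x) v)" using Suc.prems by simp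
    then show ?thesis
      by (induction k) (auto dest: Ck_on_SucD simp del: Ck_on.simps(2))
  qed
  then have F'cont: "continuous_on S ?F'"
    using F' by (intro continuous_on_blinfun_componentwise) (simp cong: continuous_on_cong)
  show ?case
  proof (rule Ck_on_SucI[OF \<open>open S\<close>])
    fix x assume x: "x \<in> S"
    let ?I = "\<lambda>x. integral (cbox 0 1) (\<lambda>t. t ^ Suc m *\<^sub>R ?F' (?y x t))"
    have "((\<lambda>x. integral (cbox 0 1) (\<lambda>t. t ^ m * F (?y x t))) has_derivative ?I x) (at x within S)"
    proof (rule leibniz_rule)
      show "((\<lambda>x. t ^ m * F (?y x t)) has_derivative blinfun_apply (t ^ Suc m *\<^sub>R ?F' (?y x t)))
          (at x within S)" if "x \<in> S" "t \<in> cbox 0 1" for x t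
      proof -
        have y: "?y x t \<in> S" using ray_in_convex[OF assms(2,3)] that by simp
        have "((\<lambda>x. ?y x t) has_derivative (\<lambda>v. t *\<^sub>R v)) (at x)"
          by (auto intro!: derivative_eq_intros)
        from diff_chain_at[OF this Ck_on_SucE[OF assms(1) Suc.prems y]]
        have "((\<lambda>x. F (?y x t)) has_derivative (\<lambda>v. frechet_derivative F (at (?y x t)) (t *\<^sub>R v))) (at x)"
          by (simp add: o_def)
        from has_derivative_mult_right[OF this, of "t ^ m"]
        have "((\<lambda>x. t ^ m * F (?y x t)) has_derivative blinfun_apply (t ^ Suc m *\<^sub>R ?F' (?y x t))) (at x)"
          by (rule has_derivative_eq_rhs)
            (rule ext, simp only: blinfun.scaleR_left F'[OF y]
              linear_cmul[OF has_derivative_linear[OF Ck_on_SucE[OF assms(1) Suc.prems y]]]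
              real_scaleR_def power_Suc mult_ac)
        then show ?thesis by (rule has_derivative_at_withinI)
      qed
      show "(\<lambda>t. t ^ m * F (?y x t)) integrable_on cbox 0 1" if "x \<in> S" for x
        using ray_in_convex[OF assms(2,3) that]
        by (intro integrable_continuous continuous_intros continuous_on_compose2[OF Fcont]) auto
      show "continuous_on (S \<times> cbox 0 1) (\<lambda>(x, t). t ^ Suc m *\<^sub>R ?F' (?y x t))"
        using continuous_on_ray_integrand[OF assms(2,3) F'cont, of "Suc m"] by simp
    qed (use x assms in auto)
    moreover have "blinfun_apply (?I x) =
        (\<lambda>v. integral {0..1} (\<lambda>t. t ^ Suc m * frechet_derivative F (at (?y x t)) v))"
    proof
      fix v
      have "(\<lambda>t. t ^ Suc m *\<^sub>R ?F' (?y x t)) integrable_on cbox 0 1"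
        using ray_in_convex[OF assms(2,3) x]
        by (intro integrable_continuous continuous_intros continuous_on_compose2[OF F'cont]) auto
      from blinfun_apply_integral[OF this, of v]
      have "blinfun_apply (?I x) v = integral (cbox 0 1) (\<lambda>t. blinfun_apply (t ^ Suc m *\<^sub>R ?F' (?y x t)) v)" .
      also have "\<dots> = integral {0..1} (\<lambda>t. t ^ Suc m * frechet_derivative F (at (?y x t)) v)"
        unfolding cbox_interval
        using ray_in_convex[OF assms(2,3) x] by (intro integral_cong) (simp add: F' blinfun.scaleR_left)
      finally show "blinfun_apply (?I x) v = \<dots>" .
    qed
    ultimately show "((\<lambda>x. integral {0..1} (\<lambda>t. t ^ m * F (?y x t))) has_derivative
        (\<lambda>v. integral {0..1} (\<lambda>t. t ^ Suc m * frechet_derivative F (at (?y x t)) v))) (at x)"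
      using at_within_open[OF x assms(1)] by simp
  next
    show "Ck_on k S (\<lambda>x. integral {0..1} (\<lambda>t. t ^ Suc m * frechet_derivative F (at (?y x t)) v))" for v
      using Suc.prems by (intro Suc.IH) simp
  qed
qed

text \<open>Integrate the derivative of \<open>F\<close> along the segment from \<open>x0\<close> to
  \<open>x\<close>, which convexity keeps in \<open>S\<close>. The integrand is linear in
  \<open>x - x0\<close>, so expanding that vector in \<open>Basis\<close> leaves as
  \<open>H b\<close> the integral of the partial derivative in direction \<open>b\<close>.
  Smoothness of \<open>H b\<close> is what later allows a derivation to be applied to the
  products.\<close>

lemma hadamard:
  fixes F :: "'e::euclidean_space \<Rightarrow> real"
  assumes "open S" "convex S" "x0 \<in> S" "smooth_on S F"
  obtains H where "\<And>b. smooth_on S (H b)"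
    "\<And>x. x \<in> S \<Longrightarrow> F x = F x0 + (\<Sum>b\<in>Basis. ((x - x0) \<bullet> b) * H b x)"
proof
  let ?y = "\<lambda>x t::real. x0 + t *\<^sub>R (x - x0)"
  let ?H = "\<lambda>b x. integral {0..1} (\<lambda>t. frechet_derivative F (at (?y x t)) b)"
  have Ck: "Ck_on k S F" for k
    using assms(4) by (simp add: smooth_on_def)
  have Ck': "Ck_on k S (\<lambda>x. frechet_derivative F (at x) b)" for k b
    using Ck[of "Suc k"] by simp
  show "smooth_on S (?H b)" for b
    using Ck_on_ray_integral[OF assms(1-3) Ck', where m=0] by (simp add: smooth_on_def)
  fix x assume x: "x \<in> S"
  have der: "(F has_derivative frechet_derivative F (at z)) (at z)" if "z \<in> S" for z
    using Ck_on_SucE[OF assms(1) Ck that] .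
  have "((\<lambda>t. frechet_derivative F (at (?y x t)) (x - x0)) has_integral F (?y x 1) - F (?y x 0)) {0..1}"
  proof (rule fundamental_theorem_of_calculus)
    fix t :: real assume t: "t \<in> {0..1}"
    have y: "?y x t \<in> S" using ray_in_convex[OF assms(2,3) x] t by simp
    have "((\<lambda>t. ?y x t) has_derivative (\<lambda>s. s *\<^sub>R (x - x0))) (at t)"
      by (auto intro!: derivative_eq_intros)
    from diff_chain_at[OF this der[OF y]]
    have "((\<lambda>t. F (?y x t)) has_derivative (\<lambda>s. s *\<^sub>R frechet_derivative F (at (?y x t)) (x - x0))) (at t)"
      unfolding o_def linear_cmul[OF has_derivative_linear[OF der[OF y]]] .
    then show "((\<lambda>t. F (?y x t)) has_vector_derivative frechet_derivative F (at (?y x t)) (x - x0))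
        (at t within {0..1})"
      unfolding has_vector_derivative_def by (rule has_derivative_at_withinI)
  qed simp
  moreover have "((\<lambda>t. frechet_derivative F (at (?y x t)) (x - x0)) has_integral
      (\<Sum>b\<in>Basis. ((x - x0) \<bullet> b) * ?H b x)) {0..1}"
  proof (rule has_integral_eq)
    show "((\<lambda>t. \<Sum>b\<in>Basis. ((x - x0) \<bullet> b) * frechet_derivative F (at (?y x t)) b) has_integral
      (\<Sum>b\<in>Basis. ((x - x0) \<bullet> b) * ?H b x)) {0..1}"
    proof (intro has_integral_sum has_integral_mult_right integrable_integral finite_Basis)
      fix b :: 'e
      have "continuous_on S (\<lambda>x. frechet_derivative F (at x) b)"
        using Ck'[of 0] by simp
      moreover have "continuous_on {0..1} (?y x)"
        by (intro continuous_intros)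
      ultimately have "continuous_on {0..1} (\<lambda>t. frechet_derivative F (at (?y x t)) b)"
        by (rule continuous_on_compose2) (use ray_in_convex[OF assms(2,3) x] in auto)
      then show "(\<lambda>t. frechet_derivative F (at (?y x t)) b) integrable_on {0..1}"
        by (rule integrable_continuous_real)
    qed
    fix t :: real assume t: "t \<in> {0..1}"
    have y: "?y x t \<in> S" using ray_in_convex[OF assms(2,3) x] t by simp
    interpret linear "frechet_derivative F (at (?y x t))"
      by (rule has_derivative_linear[OF der[OF y]])
    have "frechet_derivative F (at (?y x t)) (x - x0)
        = frechet_derivative F (at (?y x t)) (\<Sum>b\<in>Basis. ((x - x0) \<bullet> b) *\<^sub>R b)"
      by (simp add: euclidean_representation)
    then show "(\<Sum>b\<in>Basis. ((x - x0) \<bullet> b) * frechet_derivative F (at (?y x t)) b)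
        = frechet_derivative F (at (?y x t)) (x - x0)"
      by (simp only: sum scale real_scaleR_def)
  qed
  ultimately have "F (?y x 1) - F (?y x 0) = (\<Sum>b\<in>Basis. ((x - x0) \<bullet> b) * ?H b x)"
    by (rule has_integral_unique)
  then show "F x = F x0 + (\<Sum>b\<in>Basis. ((x - x0) \<bullet> b) * ?H b x)"
    by (simp add: diff_eq_eq)
qed

section \<open>Smooth functions and tangent vectors\<close>

lemma smooth_on_subset: "smooth_on S f \<Longrightarrow> T \<subseteq> S \<Longrightarrow> smooth_on T f"
  by (auto simp: smooth_on_def intro: Ck_on_subset)

lemma smooth_on_compose:
  fixes h :: "'f::euclidean_space \<Rightarrow> real" and \<phi> :: "'e::euclidean_space \<Rightarrow> 'f"
  assumes "open S" "open T" "\<phi> ` S \<subseteq> T" "smooth_on T h" "smooth_on S \<phi>"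
  shows "smooth_on S (\<lambda>x. h (\<phi> x))"
  using Ck_on_compose[OF assms(1-3)] assms(4,5) by (simp add: smooth_on_def)

section \<open>Smooth functions in charts\<close>

locale manifold =
  fixes A :: "('a::{t2_space,second_countable_topology}, 'e::euclidean_space) atlas"
  assumes atlas: "smooth_atlas A"
begin

lemma ex_chart: "\<exists>U c. (U, c) \<in> A \<and> p \<in> U"
proof -
  have "p \<in> (\<Union>(U, c)\<in>A. U)"
    using atlas by (simp add: smooth_atlas_def)
  then show ?thesis by auto
qed

lemma chart:
  assumes "(U, c) \<in> A"
  shows open_chart: "open U" and "homeomorphism U (c ` U) c (inv_into U c)"
    and inv_chart: "\<And>q. q \<in> U \<Longrightarrow> inv_into U c (c q) = q"
    and continuous_chart: "continuous_on U c"
proof -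
  show "open U" and h: "homeomorphism U (c ` U) c (inv_into U c)"
    using atlas assms unfolding smooth_atlas_def by blast+
  show "\<And>q. q \<in> U \<Longrightarrow> inv_into U c (c q) = q"
    using h by (simp add: homeomorphism_apply1)
  show "continuous_on U c"
    using h by (rule homeomorphism_cont1)
qed

lemma open_chart_image:
  assumes "(U, c) \<in> A" "open W"
  shows "open (c ` (U \<inter> W))"
proof -
  have "openin (top_of_set U) (U \<inter> W)"
    using assms(2) by blast
  then have "openin (top_of_set (c ` U)) (c ` (U \<inter> W))"
    using homeomorphism_imp_open_map chart(2)[OF assms(1)] by blast
  moreover have "open (c ` U)"
    using atlas assms(1) unfolding smooth_atlas_def by blast
  ultimately show ?thesis
    using openin_open_trans by blast
qed

lemma smooth_fun_on_subset: "smooth_fun_on A W f \<Longrightarrow> V \<subseteq> W \<Longrightarrow> smooth_fun_on A V f"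
  unfolding smooth_fun_on_def by (fastforce intro: smooth_on_subset)

lemma smooth_fun_onI:
  assumes "\<And>U c k. (U, c) \<in> A \<Longrightarrow> Ck_on k (c ` (U \<inter> W)) (f \<circ> inv_into U c)"
  shows "smooth_fun_on A W f"
  using assms by (auto simp: smooth_fun_on_def smooth_on_def)

lemma smooth_fun_onD:
  assumes "smooth_fun_on A W f" "(U, c) \<in> A"
  shows "Ck_on k (c ` (U \<inter> W)) (f \<circ> inv_into U c)"
  using assms by (auto simp: smooth_fun_on_def smooth_on_def)

lemma smooth_fun_on_const: "open W \<Longrightarrow> smooth_fun_on A W (\<lambda>q. a)"
  by (rule smooth_fun_onI) (simp add: o_def Ck_on_const open_chart_image)

lemma smooth_fun_on_add:
  "open W \<Longrightarrow> smooth_fun_on A W f \<Longrightarrow> smooth_fun_on A W g \<Longrightarrow> smooth_fun_on A W (\<lambda>q. f q + g q)"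
  using Ck_on_add[OF open_chart_image smooth_fun_onD smooth_fun_onD]
  by (intro smooth_fun_onI) (simp add: o_def)

lemma smooth_fun_on_mult:
  "open W \<Longrightarrow> smooth_fun_on A W f \<Longrightarrow> smooth_fun_on A W g \<Longrightarrow> smooth_fun_on A W (\<lambda>q. f q * g q)"
  using Ck_on_mult[OF open_chart_image smooth_fun_onD smooth_fun_onD]
  by (intro smooth_fun_onI) (simp add: o_def)

lemma smooth_fun_on_sum:
  assumes "open W" "finite I" "\<And>i. i \<in> I \<Longrightarrow> smooth_fun_on A W (f i)"
  shows "smooth_fun_on A W (\<lambda>q. \<Sum>i\<in>I. f i q)"
  using assms(2,3)
proof (induction I rule: finite_induct)
  case (insert i I)
  then show ?case using smooth_fun_on_add[OF assms(1), of "f i"] by simp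
qed (simp add: smooth_fun_on_const assms(1))

text \<open>Read in another chart, the function is \<open>h\<close> after a transition map, and
  transition maps are smooth.\<close>

lemma smooth_fun_on_chart:
  assumes "(U, c) \<in> A" "open W" "W \<subseteq> U" "open T" "c ` W \<subseteq> T" "smooth_on T h"
  shows "smooth_fun_on A W (\<lambda>q. h (c q))"
  unfolding smooth_fun_on_def
proof clarify
  fix V d assume d: "(V, d) \<in> A"
  have "smooth_on (d ` (V \<inter> U)) (c \<circ> inv_into V d)"
    using atlas assms(1) d unfolding smooth_atlas_def by blast
  then have "smooth_on (d ` (V \<inter> W)) (c \<circ> inv_into V d)"
    using assms(3) by (auto intro: smooth_on_subset)
  moreover have "(c \<circ> inv_into V d) ` (d ` (V \<inter> W)) \<subseteq> T"
    using assms(5) inv_chart[OF d] by auto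
  ultimately show "smooth_on (d ` (V \<inter> W)) ((\<lambda>q. h (c q)) \<circ> inv_into V d)"
    using smooth_on_compose[OF open_chart_image[OF d assms(2)] assms(4) _ assms(6)]
    by (simp add: o_def)
qed

lemma smooth_atI: "open W \<Longrightarrow> p \<in> W \<Longrightarrow> smooth_fun_on A W f \<Longrightarrow> smooth_at A p f"
  unfolding smooth_at_def by blast

lemma smooth_at_const: "smooth_at A p (\<lambda>q. a)"
  by (rule smooth_atI[of UNIV]) (simp_all add: smooth_fun_on_const)

lemma smooth_at_add_mult:
  assumes "smooth_at A p f" "smooth_at A p g"
  shows smooth_at_add: "smooth_at A p (\<lambda>q. f q + g q)"
    and smooth_at_mult: "smooth_at A p (\<lambda>q. f q * g q)"
proof -
  obtain V W where "open V" "p \<in> V" "smooth_fun_on A V f" "open W" "p \<in> W" "smooth_fun_on A W g"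
    using assms unfolding smooth_at_def by blast
  then have "open (V \<inter> W)" "p \<in> V \<inter> W" "smooth_fun_on A (V \<inter> W) f" "smooth_fun_on A (V \<inter> W) g"
    by (auto intro: smooth_fun_on_subset)
  then show "smooth_at A p (\<lambda>q. f q + g q)" "smooth_at A p (\<lambda>q. f q * g q)"
    by (blast intro: smooth_atI smooth_fun_on_add smooth_fun_on_mult)+
qed

lemma smooth_at_sum:
  assumes "finite I" "\<And>i. i \<in> I \<Longrightarrow> smooth_at A p (f i)"
  shows "smooth_at A p (\<lambda>q. \<Sum>i\<in>I. f i q)"
  using assms
proof (induction I rule: finite_induct)
  case (insert i I)
  then show ?case using smooth_at_add[of p "f i"] by simp
qed (simp add: smooth_at_const)

lemma smooth_at_chart:
  assumes "(U, c) \<in> A" "p \<in> U" "open T" "c p \<in> T" "smooth_on T h"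
  shows "smooth_at A p (\<lambda>q. h (c q))"
proof (rule smooth_atI)
  show "open (U \<inter> c -` T)"
    using continuous_open_preimage[OF continuous_chart open_chart] assms by blast
  then show "smooth_fun_on A (U \<inter> c -` T) (\<lambda>q. h (c q))"
    using assms by (intro smooth_fun_on_chart[of U c _ T]) auto
qed (use assms in auto)

lemma smooth_at_coordinate:
  assumes "(U, c) \<in> A" "p \<in> U"
  shows "smooth_at A p (\<lambda>q. c q \<bullet> b)"
proof (rule smooth_at_chart[OF assms open_UNIV UNIV_I])
  have "Ck_on k UNIV (\<lambda>x. x)" for k
  proof (cases k)
    case (Suc l)
    show ?thesis
      unfolding Suc by (rule Ck_on_SucI[where D="\<lambda>x v. v"]) (auto intro: Ck_on_const)
  qed simp
  then show "smooth_on UNIV (\<lambda>x. x \<bullet> b)"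
    unfolding smooth_on_def using Ck_on_bounded_linear[OF open_UNIV bounded_linear_inner_left] by blast
qed

section \<open>Derivations at a point and their linear structure\<close>

lemma tangent_lincomb:
  "v \<in> tangent_space A p \<Longrightarrow> smooth_at A p f \<Longrightarrow> smooth_at A p g \<Longrightarrow>
    v (\<lambda>q. a * f q + b * g q) = a * v f + b * v g"
  unfolding tangent_space_def by blast

lemma tangent_mult:
  "v \<in> tangent_space A p \<Longrightarrow> smooth_at A p f \<Longrightarrow> smooth_at A p g \<Longrightarrow>
    v (\<lambda>q. f q * g q) = f p * v g + g p * v f"
  unfolding tangent_space_def by blast

lemma tangent_local:
  assumes "v \<in> tangent_space A p" "smooth_at A p f" "open W" "p \<in> W" "\<And>q. q \<in> W \<Longrightarrow> f q = g q"
  shows "v f = v g"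
proof -
  have "eventually (\<lambda>q. f q = g q) (nhds p)"
    using assms(3-5) eventually_nhds by blast
  then show ?thesis
    using assms(1,2) by (simp add: tangent_space_def)
qed

lemma tangent_nonsmooth: "v \<in> tangent_space A p \<Longrightarrow> \<not> smooth_at A p f \<Longrightarrow> v f = 0"
  unfolding tangent_space_def by blast

lemma tangent_add:
  "v \<in> tangent_space A p \<Longrightarrow> smooth_at A p f \<Longrightarrow> smooth_at A p g \<Longrightarrow> v (\<lambda>q. f q + g q) = v f + v g"
  using tangent_lincomb[of v p f g 1 1] by simp

lemma tangent_const:
  assumes "v \<in> tangent_space A p"
  shows "v (\<lambda>q. a) = 0"
proof -
  \<comment> \<open>The product rule for \<open>1 * 1\<close> gives
    \<open>v 1 = 2 * v 1\<close>.\<close>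
  have "v (\<lambda>q. 1) = 0"
    using tangent_mult[OF assms smooth_at_const smooth_at_const, of 1 1] by simp
  then show ?thesis
    using tangent_lincomb[OF assms smooth_at_const smooth_at_const, of a 1 0 1] by simp
qed

lemma tangent_sum:
  assumes "v \<in> tangent_space A p" "finite I" "\<And>i. i \<in> I \<Longrightarrow> smooth_at A p (f i)"
  shows "v (\<lambda>q. \<Sum>i\<in>I. f i q) = (\<Sum>i\<in>I. v (f i))"
  using assms(2,3)
proof (induction I rule: finite_induct)
  case (insert i I)
  then show ?case
    using tangent_add[OF assms(1), of "f i" "\<lambda>q. \<Sum>i\<in>I. f i q"] smooth_at_sum[of I p f] by simp
qed (simp add: tangent_const[OF assms(1)])

lemma tcomb_tangent:
  assumes "u \<in> tangent_space A p" "v \<in> tangent_space A p"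
  shows "tcomb a u b v \<in> tangent_space A p"
proof -
  let ?w = "tcomb a u b v"
  have "?w (\<lambda>q. r * f q + s * g q) = r * ?w f + s * ?w g"
    if "smooth_at A p f" "smooth_at A p g" for f g r s
    by (simp add: tcomb_def tangent_lincomb[OF assms(1) that] tangent_lincomb[OF assms(2) that] algebra_simps)
  moreover have "?w (\<lambda>q. f q * g q) = f p * ?w g + g p * ?w f"
    if "smooth_at A p f" "smooth_at A p g" for f g
    by (simp add: tcomb_def tangent_mult[OF assms(1) that] tangent_mult[OF assms(2) that] algebra_simps)
  moreover have "?w f = ?w g" if "smooth_at A p f" "eventually (\<lambda>q. f q = g q) (nhds p)" for f g
    using that assms unfolding tangent_space_def tcomb_def by simp
  moreover have "?w f = 0" if "\<not> smooth_at A p f" for f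
    by (simp add: tcomb_def tangent_nonsmooth[OF assms(1) that] tangent_nonsmooth[OF assms(2) that])
  ultimately show ?thesis unfolding tangent_space_def by blast
qed

lemma tzero_tangent: "tzero \<in> tangent_space A p"
  by (simp add: tangent_space_def tzero_def)

lemma sum_tangent:
  assumes "finite I" "\<And>i. i \<in> I \<Longrightarrow> e i \<in> tangent_space A p"
  shows "(\<lambda>f. \<Sum>i\<in>I. c i * e i f) \<in> tangent_space A p"
  using assms
proof (induction I rule: finite_induct)
  case empty
  then show ?case using tzero_tangent by (simp add: tzero_def)
next
  case (insert i I)
  then have "tcomb (c i) (e i) 1 (\<lambda>f. \<Sum>i\<in>I. c i * e i f) \<in> tangent_space A p"
    by (intro tcomb_tangent) auto
  then show ?case using insert by (simp add: tcomb_def)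
qed

text \<open>Linearity is only available as compatibility with the two-term combination
  \<open>tcomb\<close>. The passage to finite sums is made once here, for the metric, the 1-form and
  the components of the endomorphism.\<close>

lemma tangent_linear_sum:
  assumes L: "\<And>u v a b. u \<in> tangent_space A p \<Longrightarrow> v \<in> tangent_space A p \<Longrightarrow>
      L (tcomb a u b v) = a * L u + b * (L v :: real)"
    and "finite J" "\<And>i. i \<in> J \<Longrightarrow> e i \<in> tangent_space A p"
  shows "L (\<lambda>f. \<Sum>i\<in>J. c i * e i f) = (\<Sum>i\<in>J. c i * L (e i))"
  using assms(2,3)
proof (induction J rule: finite_induct)
  case empty
  show ?case
    using L[OF tzero_tangent tzero_tangent, of 0 0] by (simp add: tcomb_def)
next
  case (insert j J)
  have e: "e j \<in> tangent_space A p" "(\<lambda>f. \<Sum>i\<in>J. c i * e i f) \<in> tangent_space A p"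
    using insert.prems insert.hyps(1) by (auto intro!: sum_tangent)
  have "(\<lambda>f. \<Sum>i\<in>insert j J. c i * e i f) = tcomb (c j) (e j) 1 (\<lambda>f. \<Sum>i\<in>J. c i * e i f)"
    using insert.hyps by (simp add: tcomb_def)
  then show ?case
    using L[OF e, of "c j" 1] insert by simp
qed

text \<open>The order of quantifiers matters: \<open>h\<close> depends on \<open>f\<close> but not
  on \<open>v\<close>, so a tangent vector is determined by its values on the \<open>DIM('e)\<close>
  coordinate functions. The coefficients are the Hadamard factors at \<open>c p\<close>.\<close>

lemma tangent_in_coordinates:
  assumes "(U, c) \<in> A" "p \<in> U" "smooth_at A p f"
  obtains h where "\<And>v. v \<in> tangent_space A p \<Longrightarrow> v f = (\<Sum>b\<in>Basis. h b * v (\<lambda>q. c q \<bullet> b))"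
proof -
  obtain W where W: "open W" "p \<in> W" "smooth_fun_on A W f"
    using assms(3) unfolding smooth_at_def by blast
  have "open (c ` (U \<inter> W))" "c p \<in> c ` (U \<inter> W)"
    using open_chart_image[OF assms(1) W(1)] assms(2) W(2) by auto
  then obtain r where r: "r > 0" "ball (c p) r \<subseteq> c ` (U \<inter> W)"
    by (meson openE)
  let ?B = "ball (c p) r"
  have "smooth_on ?B (f \<circ> inv_into U c)"
    using W(3) assms(1) r(2) by (auto simp: smooth_fun_on_def intro: smooth_on_subset)
  then obtain H where H: "\<And>b. smooth_on ?B (H b)"
    "\<And>x. x \<in> ?B \<Longrightarrow> (f \<circ> inv_into U c) x = (f \<circ> inv_into U c) (c p) + (\<Sum>b\<in>Basis. ((x - c p) \<bullet> b) * H b x)"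
    by (rule hadamard[OF open_ball convex_ball centre_in_ball[THEN iffD2, OF r(1)]]) blast
  have Hs: "smooth_at A p (\<lambda>q. H b (c q))" for b
    using smooth_at_chart[OF assms(1,2) open_ball _ H(1)] r(1) by simp
  \<comment> \<open>Centred coordinates: they vanish at \<open>p\<close>, and subtracting a constant
    does not change the value of a derivation.\<close>
  let ?x = "\<lambda>b q. (c q - c p) \<bullet> b"
  have xs: "smooth_at A p (?x b)" and vx: "v \<in> tangent_space A p \<Longrightarrow> v (?x b) = v (\<lambda>q. c q \<bullet> b)" for b v
    using smooth_at_add[OF smooth_at_coordinate[OF assms(1,2)] smooth_at_const, of b "- (c p \<bullet> b)"]
      tangent_add[OF _ smooth_at_coordinate[OF assms(1,2)] smooth_at_const, of v b "- (c p \<bullet> b)"]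
    by (simp_all add: inner_diff_left tangent_const)
  \<comment> \<open>The Hadamard expansion holds only on this neighbourhood of \<open>p\<close>;
    since derivations depend on germs alone, no cutoff function is required.\<close>
  let ?N = "U \<inter> c -` ?B"
  have N: "open ?N" "p \<in> ?N"
    using continuous_open_preimage[OF continuous_chart open_chart] assms r(1) by auto
  have feq: "f q = f p + (\<Sum>b\<in>Basis. ?x b q * H b (c q))" if "q \<in> ?N" for q
    using H(2)[of "c q"] that inv_chart[OF assms(1)] assms(2) by simp
  show ?thesis
  proof
    fix v assume v: "v \<in> tangent_space A p"
    have "v f = v (\<lambda>q. f p + (\<Sum>b\<in>Basis. ?x b q * H b (c q)))"
      by (rule tangent_local[OF v assms(3) N feq])
    also have "\<dots> = (\<Sum>b\<in>Basis. v (\<lambda>q. ?x b q * H b (c q)))"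
      by (simp only: tangent_add[OF v smooth_at_const smooth_at_sum[OF finite_Basis smooth_at_mult[OF xs Hs]]]
          tangent_sum[OF v finite_Basis smooth_at_mult[OF xs Hs]] tangent_const[OF v] add_0)
    \<comment> \<open>In each product rule the term with the factor \<open>?x b p\<close> is
      zero.\<close>
    also have "\<dots> = (\<Sum>b\<in>Basis. H b (c p) * v (\<lambda>q. c q \<bullet> b))"
      using tangent_mult[OF v xs Hs] vx[OF v] by simp
    finally show "v f = (\<Sum>b\<in>Basis. H b (c p) * v (\<lambda>q. c q \<bullet> b))" .
  qed
qed

text \<open>Coordinate values embed the tangent space linearly into the model space. The images of
  \<open>DIM('e)\<close> independent vectors are then a basis there, and a combination of them equal
  to the image of \<open>v\<close> is pulled back by injectivity.\<close>

lemma independent_spans_tangent: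
  assumes "finite I" "card I = DIM('e)" "\<And>i. i \<in> I \<Longrightarrow> e i \<in> tangent_space A p"
    and indep: "\<And>k. (\<lambda>f. \<Sum>i\<in>I. k i * e i f) = tzero \<Longrightarrow> \<forall>i\<in>I. k i = 0"
    and v: "v \<in> tangent_space A p"
  obtains k where "v = (\<lambda>f. \<Sum>i\<in>I. k i * e i f)"
proof -
  obtain U c where c: "(U, c) \<in> A" "p \<in> U" using ex_chart by blast
  define L :: "'a tvec \<Rightarrow> 'e" where "L u = (\<Sum>b\<in>Basis. u (\<lambda>q. c q \<bullet> b) *\<^sub>R b)" for u
  have Lb: "L u \<bullet> b = u (\<lambda>q. c q \<bullet> b)" if "b \<in> Basis" for u b
    using that by (simp add: L_def)
  \<comment> \<open>On functions smooth at \<open>p\<close> the coordinate values decide; on all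
    others both functionals are 0 by the convention in \<open>tangent_space\<close>.\<close>
  have inj: "u = w" if "u \<in> tangent_space A p" "w \<in> tangent_space A p" "L u = L w" for u w
  proof
    fix f
    show "u f = w f"
    proof (cases "smooth_at A p f")
      case True
      then obtain h where h: "\<And>v. v \<in> tangent_space A p \<Longrightarrow> v f = (\<Sum>b\<in>Basis. h b * v (\<lambda>q. c q \<bullet> b))"
        using tangent_in_coordinates[OF c] by blast
      show ?thesis
        unfolding h[OF that(1)] h[OF that(2)]
        by (rule sum.cong) (simp_all add: Lb[symmetric] that(3))
    next
      case False
      then show ?thesis using tangent_nonsmooth that by metis
    qed
  qed
  have Lsum: "L (\<lambda>f. \<Sum>i\<in>I. k i * e i f) = (\<Sum>i\<in>I. k i *\<^sub>R L (e i))" for k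
    by (rule euclidean_eqI) (simp add: Lb inner_sum_left)
  have Lindep: "\<forall>i\<in>I. k i = 0" if "(\<Sum>i\<in>I. k i *\<^sub>R L (e i)) = 0" for k
  proof (rule indep, rule inj[OF sum_tangent[OF assms(1,3)] tzero_tangent])
    show "L (\<lambda>f. \<Sum>i\<in>I. k i * e i f) = L tzero"
      unfolding Lsum that by (simp add: L_def tzero_def)
  qed
  have Linj: "inj_on (\<lambda>i. L (e i)) I"
  proof (rule inj_onI, rule ccontr)
    fix i j assume ij: "i \<in> I" "j \<in> I" "L (e i) = L (e j)" "i \<noteq> j"
    \<comment> \<open>Independence and span concern the set of images, so repetitions in the family
      must be excluded. If the images at \<open>i\<close> and \<open>j\<close> agreed, the
      coefficients 1 at \<open>i\<close> and -1 at \<open>j\<close> would give a relation.\<close>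
    let ?k = "\<lambda>l. (if l = i then 1 else 0) - (if l = j then 1 else (0::real))"
    have "(\<Sum>l\<in>I. ?k l *\<^sub>R L (e l)) = 0"
      using ij assms(1) by (simp add: scaleR_diff_left sum_subtractf if_distrib[of "\<lambda>x. x *\<^sub>R _"] cong: if_cong)
    from Lindep[OF this] ij show False by auto
  qed
  let ?S = "(\<lambda>i. L (e i)) ` I"
  have "independent ?S"
    unfolding independent_explicit
  proof (intro conjI allI impI)
    fix k assume "(\<Sum>x\<in>?S. k x *\<^sub>R x) = 0"
    then have "(\<Sum>i\<in>I. k (L (e i)) *\<^sub>R L (e i)) = 0"
      by (simp add: sum.reindex[OF Linj])
    from Lindep[OF this] show "\<forall>x\<in>?S. k x = 0" by auto
  qed (use assms(1) in simp)
  then have "UNIV \<subseteq> span ?S"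
    using card_image[OF Linj] assms(2) by (intro card_ge_dim_independent) auto
  then have "L v \<in> span ?S" by blast
  then obtain k where "L v = (\<Sum>x\<in>?S. k x *\<^sub>R x)"
    using span_finite[of ?S] assms(1) by auto
  then have "L v = L (\<lambda>f. \<Sum>i\<in>I. k (L (e i)) * e i f)"
    by (simp add: Lsum sum.reindex[OF Linj])
  moreover have "(\<lambda>f. \<Sum>i\<in>I. k (L (e i)) * e i f) \<in> tangent_space A p"
    using assms(1,3) by (rule sum_tangent)
  ultimately have "v = (\<lambda>f. \<Sum>i\<in>I. k (L (e i)) * e i f)"
    using inj[OF v] by blast
  then show ?thesis by (rule that)
qed

end

section \<open>Levi-Civita connection of a pseudo-orthonormal frame\<close>

lemma sum_rotate:
  "(\<Sum>i\<in>I. \<Sum>j\<in>J. \<Sum>k\<in>K. f i j k) = (\<Sum>k\<in>K. \<Sum>i\<in>I. \<Sum>j\<in>J. f i j k)"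
proof -
  have "(\<Sum>i\<in>I. \<Sum>j\<in>J. \<Sum>k\<in>K. f i j k) = (\<Sum>i\<in>I. \<Sum>k\<in>K. \<Sum>j\<in>J. f i j k)"
    by (intro sum.cong refl sum.swap)
  also have "\<dots> = (\<Sum>k\<in>K. \<Sum>i\<in>I. \<Sum>j\<in>J. f i j k)"
    by (rule sum.swap)
  finally show ?thesis .
qed

locale pseudo_orthonormal_frame = manifold A
  for A :: "('a::{t2_space,second_countable_topology}, 'e::euclidean_space) atlas" +
  fixes I :: "'i set" and E :: "'i \<Rightarrow> 'a vfield" and s :: "'i \<Rightarrow> real"
    and g :: "'a \<Rightarrow> 'a tvec \<Rightarrow> 'a tvec \<Rightarrow> real" and C :: "'i \<Rightarrow> 'i \<Rightarrow> 'i \<Rightarrow> real"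
  assumes finite_I: "finite I" and card_I: "card I = DIM('e)"
    and frame: "\<And>i. i \<in> I \<Longrightarrow> vector_field A (E i)"
    and bilinear: "bilinear_field A g"
    and orthonormal: "\<And>p i j. i \<in> I \<Longrightarrow> j \<in> I \<Longrightarrow> g p (E i p) (E j p) = (if i = j then s i else 0)"
    and sign: "\<And>i. i \<in> I \<Longrightarrow> s i * s i = 1"
    and bracket: "\<And>i j. i \<in> I \<Longrightarrow> j \<in> I \<Longrightarrow>
      lie_bracket A (E i) (E j) = (\<lambda>p f. \<Sum>k\<in>I. C i j k * E k p f)"
    and antisym: "\<And>i j k. i \<in> I \<Longrightarrow> j \<in> I \<Longrightarrow> k \<in> I \<Longrightarrow> C i j k = - C j i k"
begin

section \<open>Components and the metric in the frame\<close>

lemma field_tangent: "vector_field A X \<Longrightarrow> X p \<in> tangent_space A p"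
  by (simp add: vector_field_def)

lemma field_smooth:
  "vector_field A X \<Longrightarrow> open W \<Longrightarrow> smooth_fun_on A W f \<Longrightarrow> smooth_fun_on A W (\<lambda>p. X p f)"
  by (simp add: vector_field_def)

lemma field_smooth_at: "vector_field A X \<Longrightarrow> smooth_at A p f \<Longrightarrow> smooth_at A p (\<lambda>q. X q f)"
  unfolding smooth_at_def using field_smooth by blast

lemma frame_tangent: "i \<in> I \<Longrightarrow> E i p \<in> tangent_space A p"
  using frame field_tangent by blast

lemma metric_tcomb:
  assumes "u \<in> tangent_space A p" "v \<in> tangent_space A p" "w \<in> tangent_space A p"
  shows "g p (tcomb a u b v) w = a * g p u w + b * g p v w"
    and "g p w (tcomb a u b v) = a * g p w u + b * g p w v"
  using bilinear assms unfolding bilinear_field_def by blast+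

lemma metric_sum:
  assumes "w \<in> tangent_space A p" "finite J" "\<And>i. i \<in> J \<Longrightarrow> e i \<in> tangent_space A p"
  shows "g p (\<lambda>f. \<Sum>i\<in>J. c i * e i f) w = (\<Sum>i\<in>J. c i * g p (e i) w)"
    and "g p w (\<lambda>f. \<Sum>i\<in>J. c i * e i f) = (\<Sum>i\<in>J. c i * g p w (e i))"
  using tangent_linear_sum[of p "\<lambda>v. g p v w" J e c] tangent_linear_sum[of p "\<lambda>v. g p w v" J e c]
  by (simp_all add: assms metric_tcomb)

text \<open>The dual coframe: as \<open>s i * s i = 1\<close>, the factor \<open>s i\<close> divides
  by the value of \<open>g\<close> on the pair \<open>E i\<close>, \<open>E i\<close>.\<close>

definition coord :: "'i \<Rightarrow> 'a \<Rightarrow> 'a tvec \<Rightarrow> real" where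
  "coord i p v = s i * g p v (E i p)"

lemma coord_frame_sum:
  assumes "i \<in> I"
  shows "coord i p (\<lambda>f. \<Sum>j\<in>I. c j * E j p f) = c i"
proof -
  have "coord i p (\<lambda>f. \<Sum>j\<in>I. c j * E j p f) = s i * (\<Sum>j\<in>I. if i = j then c j * s j else 0)"
    using assms finite_I frame_tangent orthonormal
    by (simp add: coord_def metric_sum if_distrib[of "\<lambda>x. _ * x"] eq_commute cong: if_cong sum.cong)
  then show ?thesis
    using assms finite_I sign[OF assms] by (simp add: mult.left_commute)
qed

text \<open>\<open>coord i\<close> applied to a vanishing combination of the frame returns its
  coefficient, so the frame is independent at \<open>p\<close>; by the dimension count it spans, and
  \<open>coord\<close> then reads off the coefficients.\<close>

lemma frame_expansion:
  assumes "v \<in> tangent_space A p"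
  shows "v = (\<lambda>f. \<Sum>i\<in>I. coord i p v * E i p f)"
proof -
  have "\<forall>i\<in>I. k i = 0" if k: "(\<lambda>f. \<Sum>i\<in>I. k i * E i p f) = tzero" for k
  proof
    fix i assume i: "i \<in> I"
    have "coord i p tzero = k i" using coord_frame_sum[OF i, of p k] unfolding k .
    moreover have "coord i p tzero = 0" using coord_frame_sum[OF i, of p "\<lambda>j. 0"] by (simp add: tzero_def)
    ultimately show "k i = 0" by simp
  qed
  then obtain k where k: "v = (\<lambda>f. \<Sum>i\<in>I. k i * E i p f)"
    using independent_spans_tangent[OF finite_I card_I frame_tangent, of "\<lambda>i. i" p v] assms by blast
  have "coord i p v = k i" if "i \<in> I" for i
    unfolding k by (rule coord_frame_sum[OF that])
  then show ?thesis
    using k by (simp cong: sum.cong)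
qed

lemma tangent_eqI:
  assumes "u \<in> tangent_space A p" "v \<in> tangent_space A p" "\<And>i. i \<in> I \<Longrightarrow> coord i p u = coord i p v"
  shows "u = v"
proof -
  have "(\<lambda>f. \<Sum>i\<in>I. coord i p u * E i p f) = (\<lambda>f. \<Sum>i\<in>I. coord i p v * E i p f)"
    using assms(3) by (simp cong: sum.cong)
  then show ?thesis
    using frame_expansion[OF assms(1)] frame_expansion[OF assms(2)] by simp
qed

lemma tcomb_apply: "tcomb a u b v f = a * u f + b * v f"
  by (simp add: tcomb_def)

lemma coord_tcomb:
  "i \<in> I \<Longrightarrow> u \<in> tangent_space A p \<Longrightarrow> v \<in> tangent_space A p \<Longrightarrow>
    coord i p (tcomb a u b v) = a * coord i p u + b * coord i p v"
  by (simp add: coord_def metric_tcomb frame_tangent algebra_simps)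

lemma coord_scale:
  assumes "i \<in> I" "u \<in> tangent_space A p"
  shows "coord i p (\<lambda>f. a * u f) = a * coord i p u"
  using coord_tcomb[OF assms(1,2,2), of a 0] by (simp add: tcomb_def)

lemma coord_frame: "i \<in> I \<Longrightarrow> j \<in> I \<Longrightarrow> coord i p (E j p) = (if i = j then 1 else 0)"
  by (simp add: coord_def orthonormal sign)

lemma metric_coord:
  assumes "u \<in> tangent_space A p" "v \<in> tangent_space A p"
  shows "g p u v = (\<Sum>i\<in>I. s i * coord i p u * coord i p v)"
proof -
  have "g p u v = (\<Sum>i\<in>I. coord i p v * g p u (E i p))"
    by (subst frame_expansion[OF assms(2)])
      (rule metric_sum(2)[OF assms(1) finite_I frame_tangent])
  also have "\<dots> = (\<Sum>i\<in>I. s i * coord i p u * coord i p v)"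
    using sign by (intro sum.cong) (auto simp: coord_def[of _ p u] mult.assoc[symmetric])
  finally show ?thesis .
qed

text \<open>\<open>bilinear_field\<close> does not contain symmetry; it is inherited from the
  diagonal form of \<open>g\<close> in the frame.\<close>

lemma metric_sym: "u \<in> tangent_space A p \<Longrightarrow> v \<in> tangent_space A p \<Longrightarrow> g p u v = g p v u"
  by (simp add: metric_coord mult_ac)

lemma coord_smooth:
  assumes "i \<in> I" "vector_field A X"
  shows "smooth_fun_on A UNIV (\<lambda>p. coord i p (X p))"
proof -
  have "smooth_fun_on A UNIV (\<lambda>p. g p (X p) (E i p))"
    using bilinear assms frame unfolding bilinear_field_def by blast
  then show ?thesis
    unfolding coord_def by (intro smooth_fun_on_mult smooth_fun_on_const open_UNIV)
qed

lemma coord_smooth_at: "i \<in> I \<Longrightarrow> vector_field A X \<Longrightarrow> smooth_at A p (\<lambda>p. coord i p (X p))"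
  by (rule smooth_atI[OF open_UNIV UNIV_I coord_smooth])

lemma frame_sum_field:
  assumes "\<And>i. i \<in> I \<Longrightarrow> smooth_fun_on A UNIV (a i)"
  shows "vector_field A (\<lambda>p f. \<Sum>i\<in>I. a i p * E i p f)"
  unfolding vector_field_def
proof (intro conjI allI impI)
  show "(\<lambda>f. \<Sum>i\<in>I. a i p * E i p f) \<in> tangent_space A p" for p
    by (rule sum_tangent[OF finite_I frame_tangent])
  show "smooth_fun_on A W (\<lambda>p. \<Sum>i\<in>I. a i p * E i p f)" if "open W" "smooth_fun_on A W f" for W f
    using that assms frame
    by (intro smooth_fun_on_sum smooth_fun_on_mult finite_I) (auto intro: field_smooth smooth_fun_on_subset)
qed

text \<open>
  Koszul's formula on the frame: \<open>christoffel i j k\<close> is the component of \<open>\<nabla>\<^bsub>E i\<^esub> (E j)\<close>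
  along \<open>E k\<close>.
\<close>

definition christoffel :: "'i \<Rightarrow> 'i \<Rightarrow> 'i \<Rightarrow> real" where
  "christoffel i j k = s k / 2 * (s k * C i j k - s i * C j k i + s j * C k i j)"

lemma christoffel_torsion:
  assumes "i \<in> I" "j \<in> I" "k \<in> I"
  shows "christoffel i j k - christoffel j i k = C i j k"
proof -
  have "C j i k = - C i j k" "C i k j = - C k i j" "C k j i = - C j k i"
    using antisym assms by blast+
  then have "christoffel i j k - christoffel j i k = (s k * s k) * C i j k"
    by (simp add: christoffel_def field_simps)
  then show ?thesis by (simp add: sign[OF assms(3)])
qed

lemma christoffel_metric:
  assumes "i \<in> I" "j \<in> I" "k \<in> I"
  shows "s k * christoffel i j k + s j * christoffel i k j = 0"
proof -
  have "s k * christoffel i j k = (s k * s k) * (s k * C i j k - s i * C j k i + s j * C k i j) / 2"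
    "s j * christoffel i k j = (s j * s j) * (s j * C i k j - s i * C k j i + s k * C j i k) / 2"
    by (simp_all add: christoffel_def)
  moreover have "C j i k = - C i j k" "C i k j = - C k i j" "C k j i = - C j k i"
    using antisym assms by blast+
  ultimately show ?thesis
    by (simp add: sign assms)
qed

section \<open>Existence of the Levi-Civita connection\<close>

definition conn_coord :: "'a vfield \<Rightarrow> 'a vfield \<Rightarrow> 'i \<Rightarrow> 'a \<Rightarrow> real" where
  "conn_coord X Y k p = X p (\<lambda>q. coord k q (Y q)) +
     (\<Sum>i\<in>I. \<Sum>j\<in>I. coord i p (X p) * coord j p (Y p) * christoffel i j k)"

definition conn :: "'a vfield \<Rightarrow> 'a vfield \<Rightarrow> 'a vfield" where
  "conn X Y = (\<lambda>p f. \<Sum>k\<in>I. conn_coord X Y k p * E k p f)"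

lemma coord_conn: "k \<in> I \<Longrightarrow> coord k p (conn X Y p) = conn_coord X Y k p"
  unfolding conn_def by (rule coord_frame_sum)

lemma conn_field:
  assumes "vector_field A X" "vector_field A Y"
  shows "vector_field A (conn X Y)"
  unfolding conn_def
proof (rule frame_sum_field)
  fix k assume k: "k \<in> I"
  have "smooth_fun_on A UNIV (\<lambda>p. X p (\<lambda>q. coord k q (Y q)))"
    by (rule field_smooth[OF assms(1) open_UNIV coord_smooth[OF k assms(2)]])
  moreover have "smooth_fun_on A UNIV
      (\<lambda>p. \<Sum>i\<in>I. \<Sum>j\<in>I. coord i p (X p) * coord j p (Y p) * christoffel i j k)"
    using assms
    by (intro smooth_fun_on_sum smooth_fun_on_mult smooth_fun_on_const coord_smooth open_UNIV finite_I)
  ultimately show "smooth_fun_on A UNIV (conn_coord X Y k)"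
    unfolding conn_coord_def by (rule smooth_fun_on_add[OF open_UNIV])
qed

lemma tcomb_field:
  assumes "vector_field A X" "vector_field A Y" "smooth_fun_on A UNIV f" "smooth_fun_on A UNIV h"
  shows "vector_field A (\<lambda>p. tcomb (f p) (X p) (h p) (Y p))"
  unfolding vector_field_def
proof (intro conjI allI impI)
  show "tcomb (f p) (X p) (h p) (Y p) \<in> tangent_space A p" for p
    using assms by (intro tcomb_tangent field_tangent)
  show "smooth_fun_on A W (\<lambda>p. tcomb (f p) (X p) (h p) (Y p) u)"
    if "open W" "smooth_fun_on A W u" for W u
    unfolding tcomb_def using that assms
    by (intro smooth_fun_on_add smooth_fun_on_mult) (auto intro: field_smooth smooth_fun_on_subset)
qed

lemma scale_field:
  assumes "vector_field A X" "smooth_fun_on A UNIV f"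
  shows "vector_field A (\<lambda>p u. f p * X p u)"
  using tcomb_field[OF assms(1,1,2) smooth_fun_on_const[OF open_UNIV, of 0]] by (simp add: tcomb_def)

lemma field_eqI:
  assumes "vector_field A X" "vector_field A Y" "\<And>p i. i \<in> I \<Longrightarrow> coord i p (X p) = coord i p (Y p)"
  shows "X = Y"
proof
  show "X p = Y p" for p
    using assms by (intro tangent_eqI[of _ p]) (simp_all add: field_tangent)
qed

lemma field_lincomb:
  assumes "vector_field A X" "smooth_at A p f" "smooth_at A p h"
  shows "X p (\<lambda>q. a * f q + b * h q) = a * X p f + b * X p h"
  by (rule tangent_lincomb[OF field_tangent[OF assms(1)] assms(2,3)])

lemma conn_affine: "affine_connection A conn"
  unfolding affine_connection_def
proof (intro conjI allI impI)
  fix X Y Z :: "'a vfield" and f h :: "'a \<Rightarrow> real"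
  assume X: "vector_field A X" and Y: "vector_field A Y" and Z: "vector_field A Z"
    and f: "smooth_fun_on A UNIV f" and h: "smooth_fun_on A UNIV h"
  show "conn (\<lambda>p. tcomb (f p) (X p) (h p) (Y p)) Z = (\<lambda>p. tcomb (f p) (conn X Z p) (h p) (conn Y Z p))"
  proof (rule field_eqI)
    fix p k assume k: "k \<in> I"
    have "conn_coord (\<lambda>p. tcomb (f p) (X p) (h p) (Y p)) Z k p = f p * conn_coord X Z k p + h p * conn_coord Y Z k p"
      by (simp add: conn_coord_def coord_tcomb field_tangent X Y tcomb_apply
          sum_distrib_left sum.distrib distrib_right distrib_left mult.assoc cong: sum.cong)
    then show "coord k p (conn (\<lambda>p. tcomb (f p) (X p) (h p) (Y p)) Z p)
        = coord k p (tcomb (f p) (conn X Z p) (h p) (conn Y Z p))"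
      by (simp add: coord_conn coord_tcomb k field_tangent conn_field X Y Z)
  qed (intro conn_field tcomb_field X Y Z f h)+
next
  fix X Y Z :: "'a vfield" and a b :: real
  assume X: "vector_field A X" and Y: "vector_field A Y" and Z: "vector_field A Z"
  show "conn X (\<lambda>p. tcomb a (Y p) b (Z p)) = (\<lambda>p. tcomb a (conn X Y p) b (conn X Z p))"
  proof (rule field_eqI)
    fix p k assume k: "k \<in> I"
    have "conn_coord X (\<lambda>p. tcomb a (Y p) b (Z p)) k p = a * conn_coord X Y k p + b * conn_coord X Z k p"
      by (simp add: conn_coord_def coord_tcomb k field_tangent Y Z field_lincomb[OF X coord_smooth_at coord_smooth_at]
          sum_distrib_left sum.distrib algebra_simps cong: sum.cong)
    then show "coord k p (conn X (\<lambda>p. tcomb a (Y p) b (Z p)) p)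
        = coord k p (tcomb a (conn X Y p) b (conn X Z p))"
      by (simp add: coord_conn coord_tcomb k field_tangent conn_field X Y Z)
  qed (intro conn_field tcomb_field X Y Z smooth_fun_on_const open_UNIV)+
next
  fix X Y :: "'a vfield" and f :: "'a \<Rightarrow> real"
  assume X: "vector_field A X" and Y: "vector_field A Y" and f: "smooth_fun_on A UNIV f"
  have fY: "vector_field A (\<lambda>p u. f p * Y p u)"
    by (rule scale_field[OF Y f])
  have Xf: "smooth_fun_on A UNIV (\<lambda>p. X p f)"
    by (rule field_smooth[OF X open_UNIV f])
  show "conn X (\<lambda>p u. f p * Y p u) = (\<lambda>p. tcomb (X p f) (Y p) (f p) (conn X Y p))"
  proof (rule field_eqI)
    fix p k assume k: "k \<in> I"
    have "X p (\<lambda>q. f q * coord k q (Y q)) = f p * X p (\<lambda>q. coord k q (Y q)) + coord k p (Y p) * X p f"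
      by (rule tangent_mult[OF field_tangent[OF X] smooth_atI[OF open_UNIV UNIV_I f] coord_smooth_at[OF k Y]])
    then have "conn_coord X (\<lambda>p u. f p * Y p u) k p = X p f * coord k p (Y p) + f p * conn_coord X Y k p"
      by (simp add: conn_coord_def coord_scale k field_tangent Y
          sum_distrib_left algebra_simps cong: sum.cong)
    then show "coord k p (conn X (\<lambda>p u. f p * Y p u) p) = coord k p (tcomb (X p f) (Y p) (f p) (conn X Y p))"
      by (simp add: coord_conn coord_tcomb k field_tangent conn_field X Y)
  qed (intro conn_field tcomb_field X Y fY f Xf)+
qed (rule conn_field)

text \<open>Expanding \<open>Y\<close> before differentiating separates derivatives of components
  from iterated derivatives along frame fields. Exchanging \<open>X\<close> and \<open>Y\<close> and
  subtracting leaves only frame brackets from the second sum, so the bracket of arbitrary fields is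
  reduced to \<open>C\<close>.\<close>

lemma iterated_derivative:
  assumes X: "vector_field A X" and Y: "vector_field A Y" and f: "smooth_at A p f"
  shows "X p (\<lambda>q. Y q f) = (\<Sum>k\<in>I. X p (\<lambda>q. coord k q (Y q)) * E k p f) +
    (\<Sum>i\<in>I. \<Sum>j\<in>I. coord i p (X p) * coord j p (Y p) * E i p (\<lambda>q. E j q f))"
proof -
  have Ef: "smooth_at A p (\<lambda>q. E j q f)" if "j \<in> I" for j
    using field_smooth_at[OF frame[OF that] f] .
  have "(\<lambda>q. Y q f) = (\<lambda>q. \<Sum>j\<in>I. coord j q (Y q) * E j q f)"
    using frame_expansion[OF field_tangent[OF Y]] by (intro ext) metis
  then have "X p (\<lambda>q. Y q f) = X p (\<lambda>q. \<Sum>j\<in>I. coord j q (Y q) * E j q f)" by simp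
  also have "\<dots> = (\<Sum>j\<in>I. X p (\<lambda>q. coord j q (Y q) * E j q f))"
    by (rule tangent_sum[OF field_tangent[OF X] finite_I smooth_at_mult[OF coord_smooth_at[OF _ Y] Ef]])
  also have "\<dots> = (\<Sum>j\<in>I. coord j p (Y p) * X p (\<lambda>q. E j q f) + E j p f * X p (\<lambda>q. coord j q (Y q)))"
    by (intro sum.cong refl tangent_mult[OF field_tangent[OF X] coord_smooth_at[OF _ Y] Ef])
  also have "\<dots> = (\<Sum>k\<in>I. X p (\<lambda>q. coord k q (Y q)) * E k p f) +
      (\<Sum>j\<in>I. coord j p (Y p) * X p (\<lambda>q. E j q f))"
    by (simp add: sum.distrib mult.commute)
  also have "(\<Sum>j\<in>I. coord j p (Y p) * X p (\<lambda>q. E j q f)) =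
      (\<Sum>j\<in>I. \<Sum>i\<in>I. coord i p (X p) * coord j p (Y p) * E i p (\<lambda>q. E j q f))"
  proof (rule sum.cong[OF refl])
    fix j
    have "X p (\<lambda>q. E j q f) = (\<Sum>i\<in>I. coord i p (X p) * E i p (\<lambda>q. E j q f))"
      using frame_expansion[OF field_tangent[OF X]] by metis
    then show "coord j p (Y p) * X p (\<lambda>q. E j q f) =
      (\<Sum>i\<in>I. coord i p (X p) * coord j p (Y p) * E i p (\<lambda>q. E j q f))"
      by (simp add: sum_distrib_left mult_ac)
  qed
  also have "\<dots> = (\<Sum>i\<in>I. \<Sum>j\<in>I. coord i p (X p) * coord j p (Y p) * E i p (\<lambda>q. E j q f))"
    by (rule sum.swap)
  finally show ?thesis .
qed

lemma conn_torsion_free: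
  assumes X: "vector_field A X" and Y: "vector_field A Y"
  shows "(\<lambda>p. tcomb 1 (conn X Y p) (-1) (conn Y X p)) = lie_bracket A X Y"
proof (intro ext)
  fix p f
  show "tcomb 1 (conn X Y p) (-1) (conn Y X p) f = lie_bracket A X Y p f"
  proof (cases "smooth_at A p f")
    \<comment> \<open>Both sides are 0 by convention: \<open>lie_bracket\<close> by its definition,
      the connection because its values are tangent vectors.\<close>
    case False
    then show ?thesis
      using tangent_nonsmooth[OF field_tangent[OF conn_field[OF X Y]] False]
        tangent_nonsmooth[OF field_tangent[OF conn_field[OF Y X]] False]
      by (simp add: lie_bracket_def tcomb_def)
  next
    case True
    let ?x = "\<lambda>i. coord i p (X p)" and ?y = "\<lambda>i. coord i p (Y p)"
    have br: "E i p (\<lambda>q. E j q f) - E j p (\<lambda>q. E i q f) = (\<Sum>k\<in>I. C i j k * E k p f)"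
      if "i \<in> I" "j \<in> I" for i j
      using fun_cong[OF fun_cong[OF bracket[OF that]], of p f] True by (simp add: lie_bracket_def)
    have "lie_bracket A X Y p f = (\<Sum>k\<in>I. (X p (\<lambda>q. coord k q (Y q)) - Y p (\<lambda>q. coord k q (X q))) * E k p f) +
      ((\<Sum>i\<in>I. \<Sum>j\<in>I. ?x i * ?y j * E i p (\<lambda>q. E j q f)) - (\<Sum>j\<in>I. \<Sum>i\<in>I. ?y j * ?x i * E j p (\<lambda>q. E i q f)))"
      using True iterated_derivative[OF X Y True] iterated_derivative[OF Y X True]
      by (simp add: lie_bracket_def left_diff_distrib sum_subtractf)
    also have "(\<Sum>i\<in>I. \<Sum>j\<in>I. ?x i * ?y j * E i p (\<lambda>q. E j q f)) - (\<Sum>j\<in>I. \<Sum>i\<in>I. ?y j * ?x i * E j p (\<lambda>q. E i q f))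
      = (\<Sum>i\<in>I. \<Sum>j\<in>I. ?x i * ?y j * (E i p (\<lambda>q. E j q f) - E j p (\<lambda>q. E i q f)))"
      by (subst (2) sum.swap) (simp add: sum_subtractf[symmetric] algebra_simps)
    \<comment> \<open>The structure coefficients are rewritten as differences of
      \<open>christoffel\<close>, the form in which they appear on the connection side.\<close>
    also have "\<dots> = (\<Sum>i\<in>I. \<Sum>j\<in>I. \<Sum>k\<in>I. ?x i * ?y j * (christoffel i j k - christoffel j i k) * E k p f)"
      by (intro sum.cong refl) (simp add: br christoffel_torsion sum_distrib_left mult.assoc)
    also have "\<dots> = (\<Sum>k\<in>I. \<Sum>i\<in>I. \<Sum>j\<in>I. ?x i * ?y j * (christoffel i j k - christoffel j i k) * E k p f)"
      by (rule sum_rotate)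
    finally have lb: "lie_bracket A X Y p f =
      (\<Sum>k\<in>I. (X p (\<lambda>q. coord k q (Y q)) - Y p (\<lambda>q. coord k q (X q))) * E k p f) +
      (\<Sum>k\<in>I. (\<Sum>i\<in>I. \<Sum>j\<in>I. ?x i * ?y j * (christoffel i j k - christoffel j i k)) * E k p f)"
      by (simp add: sum_distrib_right)
    have "conn_coord X Y k p - conn_coord Y X k p =
      (X p (\<lambda>q. coord k q (Y q)) - Y p (\<lambda>q. coord k q (X q))) +
      (\<Sum>i\<in>I. \<Sum>j\<in>I. ?x i * ?y j * (christoffel i j k - christoffel j i k))" for k
    proof -
      have "(\<Sum>i\<in>I. \<Sum>j\<in>I. ?y i * ?x j * christoffel i j k) = (\<Sum>i\<in>I. \<Sum>j\<in>I. ?x i * ?y j * christoffel j i k)"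
        by (subst sum.swap) (simp add: mult_ac)
      then show ?thesis
        by (simp add: conn_coord_def right_diff_distrib sum_subtractf)
    qed
    then show ?thesis
      unfolding lb tcomb_def conn_def by (simp add: left_diff_distrib[symmetric] distrib_right[symmetric] sum_subtractf[symmetric] sum.distrib[symmetric])
  qed
qed

text \<open>In the frame \<open>g\<close> is diagonal with constant entries, so the product rule
  accounts for all derivative terms, and what remains is skew-symmetry of the lowered coefficients,
  \<open>christoffel_metric\<close>.\<close>

lemma conn_metric:
  assumes X: "vector_field A X" and Y: "vector_field A Y" and Z: "vector_field A Z"
  shows "X p (\<lambda>q. g q (Y q) (Z q)) = g p (conn X Y p) (Z p) + g p (Y p) (conn X Z p)"
proof -
  let ?x = "\<lambda>i. coord i p (X p)" and ?y = "\<lambda>i. coord i p (Y p)" and ?z = "\<lambda>i. coord i p (Z p)"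
  let ?Xy = "\<lambda>k. X p (\<lambda>q. coord k q (Y q))" and ?Xz = "\<lambda>k. X p (\<lambda>q. coord k q (Z q))"
  note sm = coord_smooth_at[OF _ Y, of _ p] coord_smooth_at[OF _ Z, of _ p]
  have "X p (\<lambda>q. g q (Y q) (Z q)) = X p (\<lambda>q. \<Sum>k\<in>I. s k * (coord k q (Y q) * coord k q (Z q)))"
    by (simp add: metric_coord field_tangent Y Z mult.assoc)
  also have "\<dots> = (\<Sum>k\<in>I. X p (\<lambda>q. s k * (coord k q (Y q) * coord k q (Z q))))"
    by (intro tangent_sum[OF field_tangent[OF X] finite_I] smooth_at_mult smooth_at_const sm)
  also have "\<dots> = (\<Sum>k\<in>I. s k * (?y k * ?Xz k + ?z k * ?Xy k))"
    by (intro sum.cong refl)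
      (simp add: tangent_mult[OF field_tangent[OF X] smooth_at_const smooth_at_mult[OF sm]]
        tangent_mult[OF field_tangent[OF X] sm] tangent_const[OF field_tangent[OF X]])
  finally have L: "X p (\<lambda>q. g q (Y q) (Z q)) = (\<Sum>k\<in>I. s k * (?y k * ?Xz k + ?z k * ?Xy k))" .
  \<comment> \<open>In the last sum the roles of \<open>j\<close> and \<open>k\<close> are
    exchanged, so that both coefficient sums carry \<open>?x i * ?y j * ?z k\<close> and can be
    added termwise once the order of summation agrees.\<close>
  have "g p (conn X Y p) (Z p) + g p (Y p) (conn X Z p) =
    (\<Sum>k\<in>I. s k * (?y k * ?Xz k + ?z k * ?Xy k)) +
    ((\<Sum>k\<in>I. \<Sum>i\<in>I. \<Sum>j\<in>I. ?x i * ?y j * ?z k * (s k * christoffel i j k)) +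
     (\<Sum>j\<in>I. \<Sum>i\<in>I. \<Sum>k\<in>I. ?x i * ?y j * ?z k * (s j * christoffel i k j)))"
    by (simp add: metric_coord field_tangent conn_field X Y Z coord_conn conn_coord_def sum_distrib_left
        sum_distrib_right sum.distrib algebra_simps cong: sum.cong)
  moreover have "(\<Sum>k\<in>I. \<Sum>i\<in>I. \<Sum>j\<in>I. ?x i * ?y j * ?z k * (s k * christoffel i j k)) =
    (\<Sum>i\<in>I. \<Sum>j\<in>I. \<Sum>k\<in>I. ?x i * ?y j * ?z k * (s k * christoffel i j k))"
    by (rule sum_rotate[symmetric])
  moreover have "(\<Sum>j\<in>I. \<Sum>i\<in>I. \<Sum>k\<in>I. ?x i * ?y j * ?z k * (s j * christoffel i k j)) =
    (\<Sum>i\<in>I. \<Sum>j\<in>I. \<Sum>k\<in>I. ?x i * ?y j * ?z k * (s j * christoffel i k j))"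
    by (rule sum.swap)
  moreover have "(\<Sum>i\<in>I. \<Sum>j\<in>I. \<Sum>k\<in>I. ?x i * ?y j * ?z k * (s k * christoffel i j k)) +
    (\<Sum>i\<in>I. \<Sum>j\<in>I. \<Sum>k\<in>I. ?x i * ?y j * ?z k * (s j * christoffel i k j)) =
    (\<Sum>i\<in>I. \<Sum>j\<in>I. \<Sum>k\<in>I. ?x i * ?y j * ?z k * (s k * christoffel i j k + s j * christoffel i k j))"
    by (simp only: sum.distrib distrib_left)
  moreover have "\<dots> = 0"
    by (simp add: christoffel_metric)
  ultimately show ?thesis using L by linarith
qed

lemma conn_levi_civita: "is_levi_civita A g conn"
  unfolding is_levi_civita_def using conn_affine conn_torsion_free conn_metric by blast

text \<open>The difference of two candidates, lowered with \<open>g\<close>, is symmetric in its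
  first two arguments since both have the same torsion, and skew in the last two since both preserve
  \<open>g\<close>. Testing against the frame fields recovers all components.\<close>

lemma levi_civita_unique:
  assumes N: "is_levi_civita A g N" and N': "is_levi_civita A g N'"
    and X: "vector_field A X" and Y: "vector_field A Y"
  shows "N X Y = N' X Y"
proof -
  define D where "D X Y Z p = g p (N X Y p) (Z p) - g p (N' X Y p) (Z p)" for X Y Z p
  have field: "vector_field A (N X Y)" "vector_field A (N' X Y)"
    if "vector_field A X" "vector_field A Y" for X Y
    using N N' that by (simp_all add: is_levi_civita_def affine_connection_def)
  have sym: "D X Y Z p = D Y X Z p"
    if X: "vector_field A X" and Y: "vector_field A Y" and Z: "vector_field A Z" for X Y Z p
  proof -
    have "(\<lambda>p. tcomb 1 (N X Y p) (-1) (N Y X p)) = lie_bracket A X Y"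
      "(\<lambda>p. tcomb 1 (N' X Y p) (-1) (N' Y X p)) = lie_bracket A X Y"
      using N N' X Y unfolding is_levi_civita_def by blast+
    then have "tcomb 1 (N X Y p) (-1) (N Y X p) = tcomb 1 (N' X Y p) (-1) (N' Y X p)" by metis
    then have "g p (tcomb 1 (N X Y p) (-1) (N Y X p)) (Z p) = g p (tcomb 1 (N' X Y p) (-1) (N' Y X p)) (Z p)"
      by simp
    then show ?thesis
      by (simp add: D_def metric_tcomb field field_tangent X Y Z)
  qed
  have skew: "D X Y Z p = - D X Z Y p"
    if X: "vector_field A X" and Y: "vector_field A Y" and Z: "vector_field A Z" for X Y Z p
  proof -
    have "X p (\<lambda>q. g q (Y q) (Z q)) = g p (N X Y p) (Z p) + g p (Y p) (N X Z p)"
      "X p (\<lambda>q. g q (Y q) (Z q)) = g p (N' X Y p) (Z p) + g p (Y p) (N' X Z p)"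
      using N N' X Y Z unfolding is_levi_civita_def by blast+
    then show ?thesis
      using metric_sym[of "Y p" p] by (simp add: D_def field field_tangent X Y Z)
  qed
  \<comment> \<open>A tensor symmetric in the first two arguments and skew in the last two vanishes.\<close>
  have D0: "D X Y Z p = 0" if Z: "vector_field A Z" for Z p
    using sym[OF X Y Z, of p] skew[OF Y X Z, of p] sym[OF Y Z X, of p] skew[OF Z Y X, of p]
      sym[OF Z X Y, of p] skew[OF X Z Y, of p] by linarith
  show ?thesis
  proof (rule field_eqI[OF field[OF X Y]])
    show "coord i p (N X Y p) = coord i p (N' X Y p)" if "i \<in> I" for p i
      using D0[OF frame[OF that], of p] by (simp add: D_def coord_def)
  qed
qed

text \<open>Existence, witnessed by \<open>conn\<close>, makes the choice in
  \<open>levi_civita\<close> a Levi-Civita connection; uniqueness then pins it down, but on vector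
  fields only.\<close>

lemma levi_civita_eq_conn:
  assumes "vector_field A X" "vector_field A Y"
  shows "levi_civita A g X Y = conn X Y"
proof -
  have "is_levi_civita A g (levi_civita A g)"
    unfolding levi_civita_def by (rule someI[of _ conn]) (rule conn_levi_civita)
  then show ?thesis
    using levi_civita_unique conn_levi_civita assms by blast
qed

end

section \<open>The covariant derivative of the endomorphism in the frame\<close>

context pseudo_orthonormal_frame
begin

text \<open>Row \<open>j\<close> of \<open>P\<close> holds the components of the image of
  \<open>E j\<close>, hence the summation over the first index.\<close>

lemma coord_endo:
  assumes \<phi>: "endo_field A \<phi>"
    and P: "\<And>j p. j \<in> I \<Longrightarrow> \<phi> p (E j p) = (\<lambda>f. \<Sum>k\<in>I. P j k * E k p f)"
    and k: "k \<in> I" and v: "v \<in> tangent_space A p"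
  shows "coord k p (\<phi> p v) = (\<Sum>j\<in>I. coord j p v * P j k)"
proof -
  have tangent: "\<phi> p u \<in> tangent_space A p" if "u \<in> tangent_space A p" for u
    using \<phi> that by (simp add: endo_field_def)
  have tcomb: "\<phi> p (tcomb a u b w) = tcomb a (\<phi> p u) b (\<phi> p w)"
    if "u \<in> tangent_space A p" "w \<in> tangent_space A p" for a b u w
    using \<phi> that by (simp add: endo_field_def)
  have "coord k p (\<phi> p (\<lambda>f. \<Sum>j\<in>I. coord j p v * E j p f)) = (\<Sum>j\<in>I. coord j p v * coord k p (\<phi> p (E j p)))"
    by (rule tangent_linear_sum[where p=p]) (simp_all add: tcomb coord_tcomb k tangent finite_I frame_tangent)
  then show ?thesis
    using frame_expansion[OF v] P coord_frame_sum[OF k] by simp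
qed

text \<open>The value of the fundamental tensor on \<open>E i\<close>, \<open>E j\<close>,
  \<open>E k\<close>: the first product comes from differentiating the image of \<open>E j\<close>,
  the second from applying the endomorphism to the derivative of \<open>E j\<close>, and
  \<open>s k\<close> lowers the index.\<close>

definition tensor_coord :: "('i \<Rightarrow> 'i \<Rightarrow> real) \<Rightarrow> 'i \<Rightarrow> 'i \<Rightarrow> 'i \<Rightarrow> real" where
  "tensor_coord P i j k = s k * (\<Sum>l\<in>I. P j l * christoffel i l k - christoffel i j l * P l k)"

text \<open>Because \<open>P\<close> is constant, the derivatives of the components of
  \<open>Y\<close> contribute the same terms to both parts of the covariant derivative. Their
  cancellation leaves an expression in the values at \<open>p\<close> alone.\<close>

lemma fundamental_tensor_coord:
  assumes \<phi>: "endo_field A \<phi>"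
    and P: "\<And>j p. j \<in> I \<Longrightarrow> \<phi> p (E j p) = (\<lambda>f. \<Sum>k\<in>I. P j k * E k p f)"
    and X: "vector_field A X" and Y: "vector_field A Y" and Z: "vector_field A Z"
  shows "fundamental_tensor A \<phi> g X Y Z p =
    (\<Sum>i\<in>I. \<Sum>j\<in>I. \<Sum>k\<in>I. coord i p (X p) * coord j p (Y p) * coord k p (Z p) * tensor_coord P i j k)"
proof -
  let ?x = "\<lambda>i. coord i p (X p)" and ?y = "\<lambda>i. coord i p (Y p)" and ?z = "\<lambda>i. coord i p (Z p)"
  let ?\<phi>Y = "\<lambda>q. \<phi> q (Y q)"
  let ?W = "tcomb 1 (levi_civita A g X ?\<phi>Y p) (-1) (\<phi> p (levi_civita A g X Y p))"
  have \<phi>Y: "vector_field A ?\<phi>Y" and tangent: "u \<in> tangent_space A p \<Longrightarrow> \<phi> p u \<in> tangent_space A p" for u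
    using \<phi> Y by (simp_all add: endo_field_def)
  have W: "?W = tcomb 1 (conn X ?\<phi>Y p) (-1) (\<phi> p (conn X Y p))"
    by (simp only: levi_civita_eq_conn[OF X Y] levi_civita_eq_conn[OF X \<phi>Y])
  have WT: "?W \<in> tangent_space A p"
    unfolding W by (intro tcomb_tangent tangent field_tangent conn_field X Y \<phi>Y)
  have cW: "coord k p ?W = (\<Sum>i\<in>I. \<Sum>j\<in>I. ?x i * ?y j * (\<Sum>l\<in>I. P j l * christoffel i l k - christoffel i j l * P l k))"
    if k: "k \<in> I" for k
  proof -
    have "X p (\<lambda>q. coord k q (?\<phi>Y q)) = X p (\<lambda>q. \<Sum>l\<in>I. coord l q (Y q) * P l k)"
      by (simp add: coord_endo[OF \<phi> P k field_tangent[OF Y]])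
    also have "\<dots> = (\<Sum>l\<in>I. X p (\<lambda>q. coord l q (Y q) * P l k))"
      by (intro tangent_sum[OF field_tangent[OF X] finite_I] smooth_at_mult smooth_at_const coord_smooth_at Y)
    also have "\<dots> = (\<Sum>l\<in>I. X p (\<lambda>q. coord l q (Y q)) * P l k)"
      by (intro sum.cong refl)
        (simp add: tangent_mult[OF field_tangent[OF X] coord_smooth_at[OF _ Y] smooth_at_const]
          tangent_const[OF field_tangent[OF X]])
    finally have D: "X p (\<lambda>q. coord k q (?\<phi>Y q)) = (\<Sum>l\<in>I. X p (\<lambda>q. coord l q (Y q)) * P l k)" .
    have "(\<Sum>l\<in>I. coord l p (?\<phi>Y p) * christoffel i l k) = (\<Sum>j\<in>I. ?y j * (\<Sum>l\<in>I. P j l * christoffel i l k))" for i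
    proof -
      have "(\<Sum>l\<in>I. coord l p (?\<phi>Y p) * christoffel i l k) = (\<Sum>l\<in>I. \<Sum>j\<in>I. ?y j * (P j l * christoffel i l k))"
        by (intro sum.cong refl)
          (simp add: coord_endo[OF \<phi> P _ field_tangent[OF Y]] sum_distrib_right mult.assoc)
      also have "\<dots> = (\<Sum>j\<in>I. \<Sum>l\<in>I. ?y j * (P j l * christoffel i l k))"
        by (rule sum.swap)
      finally show ?thesis by (simp add: sum_distrib_left)
    qed
    then have S: "(\<Sum>i\<in>I. \<Sum>l\<in>I. ?x i * coord l p (?\<phi>Y p) * christoffel i l k) =
      (\<Sum>i\<in>I. \<Sum>j\<in>I. ?x i * ?y j * (\<Sum>l\<in>I. P j l * christoffel i l k))"
      by (simp only: mult.assoc sum_distrib_left[symmetric])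
    have T: "(\<Sum>l\<in>I. (\<Sum>i\<in>I. \<Sum>j\<in>I. ?x i * ?y j * christoffel i j l) * P l k) =
      (\<Sum>i\<in>I. \<Sum>j\<in>I. ?x i * ?y j * (\<Sum>l\<in>I. christoffel i j l * P l k))"
    proof -
      have "(\<Sum>l\<in>I. (\<Sum>i\<in>I. \<Sum>j\<in>I. ?x i * ?y j * christoffel i j l) * P l k) =
        (\<Sum>l\<in>I. \<Sum>i\<in>I. \<Sum>j\<in>I. ?x i * ?y j * (christoffel i j l * P l k))"
        by (simp only: sum_distrib_right mult.assoc)
      also have "\<dots> = (\<Sum>i\<in>I. \<Sum>j\<in>I. \<Sum>l\<in>I. ?x i * ?y j * (christoffel i j l * P l k))"
        by (rule sum_rotate[symmetric])
      finally show ?thesis by (simp only: sum_distrib_left)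
    qed
    have "coord k p ?W = conn_coord X ?\<phi>Y k p - (\<Sum>l\<in>I. conn_coord X Y l p * P l k)"
      by (simp add: W coord_tcomb[OF k field_tangent[OF conn_field[OF X \<phi>Y]] tangent[OF field_tangent[OF conn_field[OF X Y]]]]
          coord_conn k coord_endo[OF \<phi> P k field_tangent[OF conn_field[OF X Y]]] cong: sum.cong)
    \<comment> \<open>By \<open>D\<close>, the derivative terms of both connection components are
      equal and cancel here.\<close>
    also have "\<dots> = (\<Sum>i\<in>I. \<Sum>l\<in>I. ?x i * coord l p (?\<phi>Y p) * christoffel i l k) -
      (\<Sum>l\<in>I. (\<Sum>i\<in>I. \<Sum>j\<in>I. ?x i * ?y j * christoffel i j l) * P l k)"
      by (simp add: conn_coord_def D distrib_right sum.distrib)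
    also have "\<dots> = (\<Sum>i\<in>I. \<Sum>j\<in>I. ?x i * ?y j * (\<Sum>l\<in>I. P j l * christoffel i l k - christoffel i j l * P l k))"
      unfolding S T by (simp only: sum_subtractf right_diff_distrib)
    finally show ?thesis .
  qed
  have "fundamental_tensor A \<phi> g X Y Z p = (\<Sum>k\<in>I. s k * coord k p ?W * ?z k)"
    unfolding fundamental_tensor_def by (rule metric_coord[OF WT field_tangent[OF Z]])
  also have "\<dots> = (\<Sum>k\<in>I. \<Sum>i\<in>I. \<Sum>j\<in>I. ?x i * ?y j * ?z k * tensor_coord P i j k)"
    by (intro sum.cong refl) (simp add: cW tensor_coord_def sum_distrib_left sum_distrib_right[of _ I "?z _"] mult_ac)
  also have "\<dots> = (\<Sum>i\<in>I. \<Sum>j\<in>I. \<Sum>k\<in>I. ?x i * ?y j * ?z k * tensor_coord P i j k)"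
    by (rule sum_rotate[symmetric])
  finally show ?thesis .
qed

end

section \<open>The five-dimensional family\<close>

text \<open>\<open>wedge a b\<close> are the components of \<open>e\<^sub>a \<and> e\<^sub>b\<close>, for the dual coframe \<open>e\<close>.\<close>

definition wedge :: "nat \<Rightarrow> nat \<Rightarrow> nat \<Rightarrow> nat \<Rightarrow> real" where
  "wedge a b i j = of_bool (i = a \<and> j = b) - of_bool (i = b \<and> j = a)"

definition frame_sign :: "nat \<Rightarrow> real" where
  "frame_sign i = (if i = 3 \<or> i = 4 then -1 else 1)"

text \<open>The differences of wedges encode that the brackets of the pairs (3,4) and (2,3) are the
  negatives of those of (1,2) and (1,4), and make skew-symmetry automatic. Frame indices start at 1
  and list positions at 0, hence \<open>k - 1\<close>; only \<open>k\<close> from 1 to 5 is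
  meant.\<close>

definition bracket_coeff :: "real \<Rightarrow> real \<Rightarrow> real \<Rightarrow> real \<Rightarrow> real \<Rightarrow> real \<Rightarrow> nat \<Rightarrow> nat \<Rightarrow> nat \<Rightarrow> real" where
  "bracket_coeff l1 l2 l3 l4 m1 m2 i j k =
     (wedge 1 2 i j - wedge 3 4 i j) * [-l1, -l2, l3, l4, 2 * m1] ! (k - 1) +
     (wedge 1 4 i j - wedge 2 3 i j) * [-l3, -l4, -l1, -l2, 2 * m2] ! (k - 1)"

lemma bracket_coeff_antisym: "bracket_coeff l1 l2 l3 l4 m1 m2 i j k = - bracket_coeff l1 l2 l3 l4 m1 m2 j i k"
  by (simp add: bracket_coeff_def wedge_def conj_commute algebra_simps)

lemma bracket_coeff_self: "bracket_coeff l1 l2 l3 l4 m1 m2 i i k = 0"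
  using bracket_coeff_antisym[of l1 l2 l3 l4 m1 m2 i i k] by simp

text \<open>The matrix of \<phi> is skew because \<open>E 1\<close> goes to \<open>E 3\<close> and
  \<open>E 3\<close> to minus \<open>E 1\<close>, and likewise for 2 and 4; so \<open>wedge\<close>
  can be reused, with the source index first.\<close>

definition phi_coeff :: "nat \<Rightarrow> nat \<Rightarrow> real" where
  "phi_coeff j k = wedge 1 3 j k + wedge 2 4 j k"

lemma atLeastAtMost_1_5: "{1..5::nat} = {1, 2, 3, 4, 5}"
  by auto

lemma sum_1_5: "(\<Sum>i\<in>{1..5::nat}. f i) = f 1 + (f 2 + (f 3 + (f 4 + f 5)))"
  unfolding atLeastAtMost_1_5 by simp

lemma mem_1_5: "i \<in> {1..5::nat} \<longleftrightarrow> i = 1 \<or> i = 2 \<or> i = 3 \<or> i = 4 \<or> i = 5"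
  by auto

locale f7_frame = pseudo_orthonormal_frame A "{1..5::nat}" E frame_sign g "bracket_coeff l1 l2 l3 l4 m1 m2"
  for A :: "('a::{t2_space,second_countable_topology}, real ^ 5) atlas"
    and E :: "nat \<Rightarrow> 'a vfield" and g :: "'a \<Rightarrow> 'a tvec \<Rightarrow> 'a tvec \<Rightarrow> real"
    and l1 l2 l3 l4 m1 m2 :: real +
  fixes \<phi> :: "'a \<Rightarrow> 'a tvec \<Rightarrow> 'a tvec" and \<eta> :: "'a \<Rightarrow> 'a tvec \<Rightarrow> real"
  assumes endo: "endo_field A \<phi>"
    and endo_frame: "\<And>j p. j \<in> {1..5} \<Longrightarrow> \<phi> p (E j p) = (\<lambda>f. \<Sum>k\<in>{1..5}. phi_coeff j k * E k p f)"
    and form: "one_form A \<eta>"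
    and form_frame: "\<And>i p. i \<in> {1..5} \<Longrightarrow> \<eta> p (E i p) = of_bool (i = 5)"
begin

context notes One_nat_def [simp del]
begin

section \<open>The almost contact B-metric structure in components\<close>

lemma phi_tangent: "v \<in> tangent_space A p \<Longrightarrow> \<phi> p v \<in> tangent_space A p"
  using endo by (simp add: endo_field_def)

lemma phi_field: "vector_field A X \<Longrightarrow> vector_field A (\<lambda>p. \<phi> p (X p))"
  using endo by (simp add: endo_field_def)

lemma coord_phi:
  assumes "v \<in> tangent_space A p"
  shows "coord 1 p (\<phi> p v) = - coord 3 p v" "coord 2 p (\<phi> p v) = - coord 4 p v"
    "coord 3 p (\<phi> p v) = coord 1 p v" "coord 4 p (\<phi> p v) = coord 2 p v" "coord 5 p (\<phi> p v) = 0"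
  by (subst coord_endo[OF endo endo_frame _ assms]; simp add: sum_1_5 phi_coeff_def wedge_def)+

lemma eta_coord:
  assumes "v \<in> tangent_space A p"
  shows "\<eta> p v = coord 5 p v"
proof -
  have "\<eta> p (\<lambda>f. \<Sum>j\<in>{1..5}. coord j p v * E j p f) = (\<Sum>j\<in>{1..5}. coord j p v * \<eta> p (E j p))"
    using form by (intro tangent_linear_sum[where p=p]) (simp_all add: one_form_def frame_tangent)
  then have "\<eta> p v = (\<Sum>j\<in>{1..5}. coord j p v * \<eta> p (E j p))"
    using frame_expansion[OF assms] by simp
  then show ?thesis
    by (simp add: sum_1_5 form_frame)
qed

lemma metric_coord_1_5:
  assumes "u \<in> tangent_space A p" "v \<in> tangent_space A p"
  shows "g p u v = coord 1 p u * coord 1 p v + coord 2 p u * coord 2 p v - coord 3 p u * coord 3 p v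
    - coord 4 p u * coord 4 p v + coord 5 p u * coord 5 p v"
  by (simp add: metric_coord[OF assms] sum_1_5 frame_sign_def)

lemma pseudo_riemannian: "pseudo_riemannian_metric 2 3 A g"
  unfolding pseudo_riemannian_metric_def
proof (intro conjI allI ballI bilinear metric_sym)
  fix p
  \<comment> \<open>The signature convention lists the negative directions first and counts from 0,
    so \<open>E 3\<close> and \<open>E 4\<close> are moved to the front.\<close>
  let ?e = "\<lambda>i. E ([3, 4, 1, 2, 5] ! i) p"
  have less_5: "i < 2 + 3 \<longleftrightarrow> i = 0 \<or> i = 1 \<or> i = 2 \<or> i = 3 \<or> i = 4" for i :: nat
    by auto
  have lessThan_5: "{..<2 + 3::nat} = {0, 1, 2, 3, 4}"
    by auto
  show "\<exists>e. (\<forall>i<2 + 3 :: nat. e i \<in> tangent_space A p) \<and>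
      (\<forall>v\<in>tangent_space A p. \<exists>c. v = (\<lambda>f. \<Sum>i<2 + 3. c i * e i f)) \<and>
      (\<forall>i<2 + 3. \<forall>j<2 + 3. g p (e i) (e j) = (if i \<noteq> j then 0 else if i < 2 then - 1 else 1))"
  proof (intro exI[of _ ?e] conjI ballI)
    show "\<forall>i<2 + 3. ?e i \<in> tangent_space A p"
      unfolding less_5 by (auto intro!: frame_tangent)
    show "\<forall>i<2 + 3. \<forall>j<2 + 3. g p (?e i) (?e j) = (if i \<noteq> j then 0 else if i < 2 then - 1 else 1)"
      unfolding less_5 by (elim disjE | intro allI impI | simp add: orthonormal frame_sign_def)+
    fix v assume "v \<in> tangent_space A p"
    then have "v = (\<lambda>f. \<Sum>i\<in>{1..5}. coord i p v * E i p f)"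
      by (rule frame_expansion)
    also have "\<dots> = (\<lambda>f. \<Sum>i<2 + 3. coord ([3, 4, 1, 2, 5] ! i) p v * ?e i f)"
      unfolding lessThan_5 sum_1_5 by (simp add: add_ac)
    finally show "\<exists>c. v = (\<lambda>f. \<Sum>i<2 + 3. c i * ?e i f)"
      by (intro exI[of _ "\<lambda>i. coord ([3, 4, 1, 2, 5] ! i) p v"])
  qed
qed

lemma almost_contact: "almost_contact_B_metric_manifold A \<phi> (E 5) \<eta> g"
  unfolding almost_contact_B_metric_manifold_def
proof (intro conjI allI ballI)
  show "\<exists>n. DIM(real ^ 5) = 2 * n + 1 \<and> pseudo_riemannian_metric n (n + 1) A g"
    using pseudo_riemannian by (intro exI[of _ 2]) simp
  fix p
  have E5: "E 5 p \<in> tangent_space A p"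
    by (simp add: frame_tangent)
  show "\<phi> p (E 5 p) = tzero"
    by (simp add: endo_frame sum_1_5 phi_coeff_def wedge_def tzero_def)
  show "\<eta> p (E 5 p) = 1"
    by (simp add: form_frame)
  fix x assume x: "x \<in> tangent_space A p"
  show "\<eta> p (\<phi> p x) = 0"
    by (simp add: eta_coord phi_tangent coord_phi x)
  show "\<phi> p (\<phi> p x) = tcomb (- 1) x (\<eta> p x) (E 5 p)"
  proof (rule tangent_eqI)
    show "coord i p (\<phi> p (\<phi> p x)) = coord i p (tcomb (- 1) x (\<eta> p x) (E 5 p))" if "i \<in> {1..5}" for i
      using that unfolding mem_1_5
      by (elim disjE) (simp_all add: coord_phi phi_tangent x eta_coord coord_tcomb E5 coord_frame)
  qed (intro phi_tangent tcomb_tangent x E5)+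
  fix y assume y: "y \<in> tangent_space A p"
  show "g p (\<phi> p x) (\<phi> p y) = - g p x y + \<eta> p x * \<eta> p y"
    by (simp add: metric_coord_1_5 phi_tangent coord_phi eta_coord x y)
qed (use atlas endo form frame in simp_all)

text \<open>A finite check over the index triples. A component can be nonzero only if exactly one of
  the last two indices is 5, and it is symmetric in these two.\<close>

lemma tensor_coord_eq:
  assumes "i \<in> {1..5}" "j \<in> {1..5}" "k \<in> {1..5}"
  shows "tensor_coord phi_coeff i j k =
    (m2 * (wedge 1 2 i j - wedge 3 4 i j) - m1 * (wedge 1 4 i j - wedge 2 3 i j)) * of_bool (k = 5) +
    (m2 * (wedge 1 2 i k - wedge 3 4 i k) - m1 * (wedge 1 4 i k - wedge 2 3 i k)) * of_bool (j = 5)"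
  using assms unfolding mem_1_5 tensor_coord_def christoffel_def sum_1_5
  by (elim disjE; simp add: bracket_coeff_def phi_coeff_def frame_sign_def wedge_def)

text \<open>On \<open>E 1, ..., E 4\<close> this is half the \<open>E 5\<close> component of the
  bracket of \<open>u\<close> with \<phi> \<open>v\<close>. Hence the factors 2 in the brackets
  disappear, and \<open>m2\<close>, which belongs to the pair (1,4), appears here with (1,2), while
  \<open>m1\<close> moves to (1,4) with a minus sign.\<close>

definition omega :: "'a \<Rightarrow> 'a tvec \<Rightarrow> 'a tvec \<Rightarrow> real" where
  "omega p u v =
     m2 * (coord 1 p u * coord 2 p v - coord 2 p u * coord 1 p v - coord 3 p u * coord 4 p v + coord 4 p u * coord 3 p v)
   - m1 * (coord 1 p u * coord 4 p v - coord 4 p u * coord 1 p v - coord 2 p u * coord 3 p v + coord 3 p u * coord 2 p v)"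

lemma fundamental_tensor_eq:
  assumes "vector_field A X" "vector_field A Y" "vector_field A Z"
  shows "fundamental_tensor A \<phi> g X Y Z p =
    omega p (X p) (Y p) * coord 5 p (Z p) + omega p (X p) (Z p) * coord 5 p (Y p)"
proof -
  have "fundamental_tensor A \<phi> g X Y Z p = (\<Sum>i\<in>{1..5}. \<Sum>j\<in>{1..5}. \<Sum>k\<in>{1..5}.
      coord i p (X p) * coord j p (Y p) * coord k p (Z p) * tensor_coord phi_coeff i j k)"
    by (rule fundamental_tensor_coord[OF endo _ assms]) (rule endo_frame)
  then show ?thesis
    unfolding sum_1_5 omega_def
    by (simp add: tensor_coord_eq wedge_def algebra_simps)
qed

lemma class_F7: "class_F7 A \<phi> (E 5) \<eta> g"
  unfolding class_F7_def Let_def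
proof (intro conjI allI impI)
  fix X Y Z p assume X: "vector_field A X" and Y: "vector_field A Y" and Z: "vector_field A Z"
  show "fundamental_tensor A \<phi> g X Y Z p + fundamental_tensor A \<phi> g Y Z X p + fundamental_tensor A \<phi> g Z X Y p = 0"
    by (simp add: fundamental_tensor_eq X Y Z omega_def algebra_simps)
  \<comment> \<open>The component \<open>coord 5\<close> vanishes on images of \<phi>, so each
    tensor on the right keeps one of its two summands, and these match the two summands on the
    left.\<close>
  show "fundamental_tensor A \<phi> g X Y Z p =
      - fundamental_tensor A \<phi> g (\<lambda>p. \<phi> p (X p)) (\<lambda>p. \<phi> p (Y p)) Z p
      - fundamental_tensor A \<phi> g (\<lambda>p. \<phi> p (X p)) Y (\<lambda>p. \<phi> p (Z p)) p"
    by (simp add: fundamental_tensor_eq phi_field X Y Z coord_phi field_tangent omega_def algebra_simps)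
qed (rule almost_contact)

end

end

theorem theorem21:
  fixes G :: "('a::{t2_space,second_countable_topology}) monoid"
    and A :: "('a, real ^ 5) atlas"
    and E :: "nat \<Rightarrow> 'a vfield"
    and \<phi> :: "'a \<Rightarrow> 'a tvec \<Rightarrow> 'a tvec"
    and \<xi> :: "'a vfield"
    and \<eta> :: "'a \<Rightarrow> 'a tvec \<Rightarrow> real"
    and g :: "'a \<Rightarrow> 'a tvec \<Rightarrow> 'a tvec \<Rightarrow> real"
    and l1 l2 l3 l4 m1 m2 :: real
  assumes "lie_group G A"
    and "connected (UNIV :: 'a set)"
    and "lie_algebra_basis G A {1..5} E"
    and "lie_bracket A (E 1) (E 2) =
          (\<lambda>p f. - l1 * E 1 p f - l2 * E 2 p f + l3 * E 3 p f + l4 * E 4 p f + 2 * m1 * E 5 p f)"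
    and "lie_bracket A (E 3) (E 4) = (\<lambda>p f. - lie_bracket A (E 1) (E 2) p f)"
    and "lie_bracket A (E 1) (E 4) =
          (\<lambda>p f. - l3 * E 1 p f - l4 * E 2 p f - l1 * E 3 p f - l2 * E 4 p f + 2 * m2 * E 5 p f)"
    and "lie_bracket A (E 2) (E 3) = (\<lambda>p f. - lie_bracket A (E 1) (E 4) p f)"
    and "lie_bracket A (E 1) (E 3) = (\<lambda>p. tzero)"
    and "lie_bracket A (E 2) (E 4) = (\<lambda>p. tzero)"
    and "\<forall>i\<in>{1..4}. lie_bracket A (E i) (E 5) = (\<lambda>p. tzero)"
    and "left_invariant_endo_field G A \<phi>"
    and "\<forall>p. \<phi> p (E 1 p) = E 3 p \<and> \<phi> p (E 2 p) = E 4 p \<and>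
           \<phi> p (E 3 p) = (\<lambda>f. - E 1 p f) \<and> \<phi> p (E 4 p) = (\<lambda>f. - E 2 p f) \<and>
           \<phi> p (E 5 p) = tzero"
    and "\<xi> = E 5"
    and "left_invariant_one_form G A \<eta>"
    and "\<forall>p. (\<forall>i\<in>{1..4}. \<eta> p (E i p) = 0) \<and> \<eta> p (E 5 p) = 1"
    and "left_invariant_bilinear_field G A g"
    and "\<forall>p. g p (E 1 p) (E 1 p) = 1 \<and> g p (E 2 p) (E 2 p) = 1 \<and>
           g p (E 3 p) (E 3 p) = -1 \<and> g p (E 4 p) (E 4 p) = -1 \<and> g p (E 5 p) (E 5 p) = 1"
    and "\<forall>p. \<forall>i\<in>{1..5}. \<forall>j\<in>{1..5}. i \<noteq> j \<longrightarrow> g p (E i p) (E j p) = 0"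
  shows "class_F7 A \<phi> \<xi> \<eta> g"
proof -
  interpret manifold A
    using assms(1) by (simp add: manifold_def lie_group_def)
  have field: "vector_field A (E i)" if "i \<in> {1..5}" for i
    using assms(3) that by (simp add: lie_algebra_basis_def left_invariant_vector_field_def)
  \<comment> \<open>The brackets are prescribed for pairs \<open>i < j\<close>; skew-symmetry
    supplies the opposite order.\<close>
  have bracket_swap: "lie_bracket A (E i) (E j) = (\<lambda>p f. \<Sum>k\<in>{1..5}. bracket_coeff l1 l2 l3 l4 m1 m2 i j k * E k p f)"
    if "lie_bracket A (E j) (E i) = (\<lambda>p f. \<Sum>k\<in>{1..5}. bracket_coeff l1 l2 l3 l4 m1 m2 j i k * E k p f)" for i j
  proof -
    have "lie_bracket A (E i) (E j) = (\<lambda>p f. - lie_bracket A (E j) (E i) p f)"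
      by (intro ext) (simp add: lie_bracket_def)
    then show ?thesis
      by (simp add: that bracket_coeff_antisym[of l1 l2 l3 l4 m1 m2 i j] sum_negf)
  qed
  have bracket_less: "lie_bracket A (E i) (E j) = (\<lambda>p f. \<Sum>k\<in>{1..5}. bracket_coeff l1 l2 l3 l4 m1 m2 i j k * E k p f)"
    if "i \<in> {1..5}" "j \<in> {1..5}" "i < j" for i j
  proof -
    have E5: "lie_bracket A (E i) (E 5) = (\<lambda>p. tzero)" if "i \<in> {1, 2, 3, 4}" for i
      using assms(10) that by auto
    show ?thesis
      using that unfolding mem_1_5 sum_1_5
      by (elim disjE; simp del: One_nat_def add: assms(4-9) E5 bracket_coeff_def wedge_def tzero_def algebra_simps)
  qed
  have "f7_frame A E g l1 l2 l3 l4 m1 m2 \<phi> \<eta>"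
  proof unfold_locales
    show "lie_bracket A (E i) (E j) = (\<lambda>p f. \<Sum>k\<in>{1..5}. bracket_coeff l1 l2 l3 l4 m1 m2 i j k * E k p f)"
      if "i \<in> {1..5}" "j \<in> {1..5}" for i j
    proof (cases i j rule: linorder_cases)
      case equal
      then show ?thesis
        by (intro ext) (simp add: lie_bracket_def bracket_coeff_self)
    qed (use that bracket_less bracket_swap in blast)+
    show "g p (E i p) (E j p) = (if i = j then frame_sign i else 0)" if "i \<in> {1..5}" "j \<in> {1..5}" for p i j
    proof (cases "i = j")
      case True
      then show ?thesis
        using that assms(17) unfolding mem_1_5 by (auto simp: frame_sign_def simp del: One_nat_def)
    qed (use that assms(18) in simp)
    show "\<phi> p (E j p) = (\<lambda>f. \<Sum>k\<in>{1..5}. phi_coeff j k * E k p f)" if "j \<in> {1..5}" for j p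
      using that assms(12) unfolding mem_1_5 sum_1_5
      by (elim disjE; simp del: One_nat_def add: phi_coeff_def wedge_def tzero_def)
    show "\<eta> p (E i p) = of_bool (i = 5)" if "i \<in> {1..5}" for i p
      using that assms(15) unfolding mem_1_5 by (elim disjE; simp)
    show "frame_sign i * frame_sign i = 1" for i
      by (simp add: frame_sign_def)
    show "bracket_coeff l1 l2 l3 l4 m1 m2 i j k = - bracket_coeff l1 l2 l3 l4 m1 m2 j i k" for i j k
      by (rule bracket_coeff_antisym)
    show "endo_field A \<phi>" "one_form A \<eta>" "bilinear_field A g"
      using assms(11,14,16) by (simp_all add: left_invariant_endo_field_def
          left_invariant_one_form_def left_invariant_bilinear_field_def)
  qed (use field in simp_all)
  then show ?thesis
    unfolding \<open>\<xi> = E 5\<close> by (rule f7_frame.class_F7)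
qed

end
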